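(* Let $\Gamma$ be the random bipartite graph. Suppose that $G$ is a closed subgroup with $Aut(\Gamma)^*\leq G\leq S_{\{l, r\}}(\Gamma)$. Let $X$ be the largest subset of $\{l, r\}$ such that $S_{X}(\Gamma)^*\subseteq G$. Then $G\subseteq S_{X}(\Gamma)^*$, and so $G= S_{X}(\Gamma)^*$.
   Context: A bipartite graph is a structure $(V,R_l,R_r,P_1,P_2)$ where $V$ is the disjoint union of nonempty sets $R_l$ and $R_r$ (the sides), and $P_1,P_2\subseteq R_l\times R_r$ are disjoint with $P_1\cup P_2=R_l\times R_r$. A pair $(a,b)\in R_l\times R_r$ is called a cross-edge; it has cross-type $P_i$ if $P_i(a,b)$ holds. For $n\in\mathbb N$, the extension property $\Theta_n$ says: for any disjoint $X_{l1},X_{l2}\subseteq R_l$ of size at most $n$ and any disjoint $X_{r1},X_{r2}\subseteq R_r$ of size at most $n$, (a) there is $v\in R_r$ such that $P_i(x,v)$ for every $x\in X_{li}$, $i=1,2$; and (b) there is $w\in R_l$ such that $P_i(w,x)$ for every $x\in X_{ri}$, $i=1,2$. The random bipartite graph $\Gamma$ is the countable bipartite graph satisfying $\Theta_n$ for every $n\in\mathbb N$; it is unique up to isomorphism. $Sym_{\{l,r\}}(\Gamma)=Sym(R_l)\times Sym(R_r)$ is the group of all permutations of the vertex set of $\Gamma$ preserving each side. "Closed" refers to the topology of pointwise convergence. $Aut(\Gamma)$ is the automorphism group of $\Gamma$ (in the language $R_l,R_r,P_1,P_2$). For a set $A$ of vertices of $\Gamma$, a bijection $\sigma:\Gamma\to\Gamma$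 is a switch with respect to $A$ if for all $(a,b)\in R_l\times R_r$ and $i=1,2$: $[P_i(a,b)\leftrightarrow P_i(\sigma(a),\sigma(b))]$ holds if and only if $|\{a,b\}\cap A|\neq 1$. A switch with respect to a vertex $v$ is a switch with respect to $\{v\}$. For $X\subseteq\{l,r\}$, $S_X(\Gamma)$ is the closed subgroup of $Sym_{\{l,r\}}(\Gamma)$ generated (as a topological group) by $Aut(\Gamma)$ together with all $\sigma\in Sym_{\{l,r\}}(\Gamma)$ that are a switch with respect to some vertex $v\in R_i$ for some $i\in X$. Fix $\rho\in Sym_{\{l,r\}}(\Gamma)$ which is a switch with respect to $R_l$ (so $\rho$ exchanges the cross-types of all cross-edges). For a subgroup $G$, $G^*$ is the closed group generated by $G$ and $\rho$. In particular $Aut(\Gamma)^*=S_\emptyset(\Gamma)^*$. *)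

theory Defs
  imports "HOL-Analysis.Analysis" "HOL-Algebra.Bij"
begin

section \<open>Bipartite graphs\<close>

record 'a bigraph =
  Rl :: "'a set"
  Rr :: "'a set"
  P1 :: "('a \<times> 'a) set"
  P2 :: "('a \<times> 'a) set"

definition verts :: "'a bigraph \<Rightarrow> 'a set" where
  "verts \<Gamma> = Rl \<Gamma> \<union> Rr \<Gamma>"

definition bipartite_graph :: "'a bigraph \<Rightarrow> bool" where
  "bipartite_graph \<Gamma> \<longleftrightarrow>
     Rl \<Gamma> \<noteq> {} \<and> Rr \<Gamma> \<noteq> {} \<and> Rl \<Gamma> \<inter> Rr \<Gamma> = {} \<and>
     P1 \<Gamma> \<inter> P2 \<Gamma> = {} \<and> P1 \<Gamma> \<union> P2 \<Gamma> = Rl \<Gamma> \<times> Rr \<Gamma>"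

definition extension_property :: "'a bigraph \<Rightarrow> nat \<Rightarrow> bool" where
  "extension_property \<Gamma> n \<longleftrightarrow>
     (\<forall>Xl1 Xl2 Xr1 Xr2.
        Xl1 \<subseteq> Rl \<Gamma> \<and> Xl2 \<subseteq> Rl \<Gamma> \<and> Xl1 \<inter> Xl2 = {} \<and>
        Xr1 \<subseteq> Rr \<Gamma> \<and> Xr2 \<subseteq> Rr \<Gamma> \<and> Xr1 \<inter> Xr2 = {} \<and>
        (\<forall>Y\<in>{Xl1, Xl2, Xr1, Xr2}. finite Y \<and> card Y \<le> n) \<longrightarrow>
        (\<exists>v\<in>Rr \<Gamma>. (\<forall>x\<in>Xl1. (x, v) \<in> P1 \<Gamma>) \<and> (\<forall>x\<in>Xl2. (x, v) \<in> P2 \<Gamma>)) \<and>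
        (\<exists>w\<in>Rl \<Gamma>. (\<forall>x\<in>Xr1. (w, x) \<in> P1 \<Gamma>) \<and> (\<forall>x\<in>Xr2. (w, x) \<in> P2 \<Gamma>)))"

text \<open>The extension properties force both sides to be infinite, so \<open>countable\<close> here
  amounts to countably infinite.\<close>

definition random_bipartite_graph :: "'a bigraph \<Rightarrow> bool" where
  "random_bipartite_graph \<Gamma> \<longleftrightarrow>
     bipartite_graph \<Gamma> \<and> countable (verts \<Gamma>) \<and> (\<forall>n. extension_property \<Gamma> n)"


section \<open>The permutation group and its topology\<close>

text \<open>As in \<open>BijGroup\<close>, a permutation of the vertex set is represented by the function that
  is \<open>undefined\<close> off the vertex set.\<close>

definition Sym_lr :: "'a bigraph \<Rightarrow> ('a \<Rightarrow> 'a) monoid" where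
  "Sym_lr \<Gamma> =
     (BijGroup (verts \<Gamma>))\<lparr>carrier := {\<sigma> \<in> Bij (verts \<Gamma>). \<sigma> ` Rl \<Gamma> = Rl \<Gamma> \<and> \<sigma> ` Rr \<Gamma> = Rr \<Gamma>}\<rparr>"

definition Sym_lr_topology :: "'a bigraph \<Rightarrow> ('a \<Rightarrow> 'a) topology" where
  "Sym_lr_topology \<Gamma> =
     subtopology (product_topology (\<lambda>_. discrete_topology (verts \<Gamma>)) (verts \<Gamma>))
       (carrier (Sym_lr \<Gamma>))"

definition closed_subgroup :: "'a bigraph \<Rightarrow> ('a \<Rightarrow> 'a) set \<Rightarrow> bool" where
  "closed_subgroup \<Gamma> H \<longleftrightarrow> subgroup H (Sym_lr \<Gamma>) \<and> closedin (Sym_lr_topology \<Gamma>) H"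

text \<open>The smallest closed subgroup containing \<open>S\<close>; meaningful for \<open>S \<subseteq> carrier (Sym_lr \<Gamma>)\<close>.\<close>

definition closed_generated :: "'a bigraph \<Rightarrow> ('a \<Rightarrow> 'a) set \<Rightarrow> ('a \<Rightarrow> 'a) set" where
  "closed_generated \<Gamma> S = closed_subgroup \<Gamma> hull S"

definition Aut :: "'a bigraph \<Rightarrow> ('a \<Rightarrow> 'a) set" where
  "Aut \<Gamma> =
     {\<sigma> \<in> Bij (verts \<Gamma>).
        (\<forall>a\<in>verts \<Gamma>. (a \<in> Rl \<Gamma> \<longleftrightarrow> \<sigma> a \<in> Rl \<Gamma>) \<and> (a \<in> Rr \<Gamma> \<longleftrightarrow> \<sigma> a \<in> Rr \<Gamma>)) \<and>
        (\<forall>a\<in>verts \<Gamma>. \<forall>b\<in>verts \<Gamma>.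
           ((a, b) \<in> P1 \<Gamma> \<longleftrightarrow> (\<sigma> a, \<sigma> b) \<in> P1 \<Gamma>) \<and> ((a, b) \<in> P2 \<Gamma> \<longleftrightarrow> (\<sigma> a, \<sigma> b) \<in> P2 \<Gamma>))}"


section \<open>Switches and the groups they generate\<close>

definition is_switch :: "'a bigraph \<Rightarrow> 'a set \<Rightarrow> ('a \<Rightarrow> 'a) \<Rightarrow> bool" where
  "is_switch \<Gamma> A \<sigma> \<longleftrightarrow>
     \<sigma> \<in> Bij (verts \<Gamma>) \<and>
     (\<forall>a\<in>Rl \<Gamma>. \<forall>b\<in>Rr \<Gamma>. \<forall>P\<in>{P1 \<Gamma>, P2 \<Gamma>}.
        ((a, b) \<in> P \<longleftrightarrow> (\<sigma> a, \<sigma> b) \<in> P) \<longleftrightarrow> card ({a, b} \<inter> A) \<noteq> 1)"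

datatype side = Lft | Rgt

fun part :: "'a bigraph \<Rightarrow> side \<Rightarrow> 'a set" where
  "part \<Gamma> Lft = Rl \<Gamma>"
| "part \<Gamma> Rgt = Rr \<Gamma>"

definition switch_group :: "'a bigraph \<Rightarrow> side set \<Rightarrow> ('a \<Rightarrow> 'a) set" where
  "switch_group \<Gamma> X =
     closed_generated \<Gamma>
       (Aut \<Gamma> \<union> {\<sigma> \<in> carrier (Sym_lr \<Gamma>). \<exists>i\<in>X. \<exists>v\<in>part \<Gamma> i. is_switch \<Gamma> {v} \<sigma>})"

definition star :: "'a bigraph \<Rightarrow> ('a \<Rightarrow> 'a) \<Rightarrow> ('a \<Rightarrow> 'a) set \<Rightarrow> ('a \<Rightarrow> 'a) set" where
  "star \<Gamma> \<rho> G = closed_generated \<Gamma> (insert \<rho> G)"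

definition is_largest :: "('b set \<Rightarrow> bool) \<Rightarrow> 'b set \<Rightarrow> bool" where
  "is_largest Q X \<longleftrightarrow> Q X \<and> (\<forall>Y. Q Y \<longrightarrow> Y \<subseteq> X)"


section \<open>Basic facts\<close>

lemma subgroup_Sym_lr: "subgroup (carrier (Sym_lr \<Gamma>)) (BijGroup (verts \<Gamma>))"
proof -
  let ?V = "verts \<Gamma>"
  interpret group "BijGroup ?V" by (rule group_BijGroup)
  have sub: "Rl \<Gamma> \<subseteq> ?V" "Rr \<Gamma> \<subseteq> ?V" by (auto simp: verts_def)
  show ?thesis
  proof (rule subgroupI)
    show "carrier (Sym_lr \<Gamma>) \<subseteq> carrier (BijGroup ?V)"
      by (auto simp: Sym_lr_def BijGroup_def)
    have "(\<lambda>x\<in>?V. x) \<in> carrier (Sym_lr \<Gamma>)"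
      using sub by (force simp: Sym_lr_def id_Bij)
    then show "carrier (Sym_lr \<Gamma>) \<noteq> {}" by blast
  next
    fix f assume f: "f \<in> carrier (Sym_lr \<Gamma>)"
    then have fB: "f \<in> Bij ?V" by (simp add: Sym_lr_def)
    then have inj: "inj_on f ?V" by (auto simp: Bij_def bij_betw_def)
    have *: "restrict (inv_into ?V f) ?V ` R = R" if "f ` R = R" "R \<subseteq> ?V" for R
    proof -
      have "restrict (inv_into ?V f) ?V ` R = inv_into ?V f ` f ` R"
        using that by (intro image_cong) auto
      also have "\<dots> = R" using inj that(2) by (rule inv_into_image_cancel)
      finally show ?thesis .
    qed
    have "restrict (inv_into ?V f) ?V \<in> carrier (Sym_lr \<Gamma>)"
      using f sub *[of "Rl \<Gamma>"] *[of "Rr \<Gamma>"] restrict_inv_into_Bij[OF fB]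
      unfolding Sym_lr_def by (simp del: image_restrict_eq)
    then show "inv\<^bsub>BijGroup ?V\<^esub> f \<in> carrier (Sym_lr \<Gamma>)"
      by (simp add: inv_BijGroup[OF fB])
  next
    fix f g assume fg: "f \<in> carrier (Sym_lr \<Gamma>)" "g \<in> carrier (Sym_lr \<Gamma>)"
    have *: "compose ?V f g ` R = R" if "f ` R = R" "g ` R = R" "R \<subseteq> ?V" for R
    proof -
      have "compose ?V f g ` R = f ` g ` R"
        unfolding image_image using that(3) by (intro image_cong) (auto simp: compose_def)
      then show ?thesis using that by simp
    qed
    show "f \<otimes>\<^bsub>BijGroup ?V\<^esub> g \<in> carrier (Sym_lr \<Gamma>)"
      using fg sub by (auto simp: Sym_lr_def BijGroup_def compose_Bij *)
  qed
qed

lemma group_Sym_lr: "group (Sym_lr \<Gamma>)"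
  using group.subgroup_imp_group[OF group_BijGroup subgroup_Sym_lr, of \<Gamma>]
  by (simp add: Sym_lr_def)

lemma topspace_Sym_lr_topology: "topspace (Sym_lr_topology \<Gamma>) = carrier (Sym_lr \<Gamma>)"
proof -
  have "Bij (verts \<Gamma>) \<subseteq> verts \<Gamma> \<rightarrow>\<^sub>E verts \<Gamma>"
    by (auto simp: Bij_def bij_betw_def PiE_def)
  then show ?thesis
    by (auto simp: Sym_lr_topology_def Sym_lr_def)
qed

lemma closed_subgroup_closed_generated:
  assumes "S \<subseteq> carrier (Sym_lr \<Gamma>)"
  shows "closed_subgroup \<Gamma> (closed_generated \<Gamma> S)"
proof -
  interpret group "Sym_lr \<Gamma>" by (rule group_Sym_lr)
  let ?A = "{H. closed_subgroup \<Gamma> H \<and> S \<subseteq> H}"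
  have ne: "?A \<noteq> {}"
  proof -
    have "carrier (Sym_lr \<Gamma>) \<in> ?A"
      using assms closedin_topspace[of "Sym_lr_topology \<Gamma>"]
      by (simp add: closed_subgroup_def subgroup_self topspace_Sym_lr_topology)
    then show ?thesis by blast
  qed
  have "subgroup (\<Inter>?A) (Sym_lr \<Gamma>)"
    using ne by (intro subgroups_Inter) (auto simp: closed_subgroup_def)
  moreover have "closedin (Sym_lr_topology \<Gamma>) (\<Inter>?A)"
    using ne by (intro closedin_Inter) (auto simp: closed_subgroup_def)
  ultimately show ?thesis
    by (simp add: closed_generated_def hull_def closed_subgroup_def)
qed

end

theory Submission
  imports Defs
begin

text \<open>Record which cross-types a permutation \<open>\<sigma>\<close> exchanges by a Boolean matrix with rows \<open>L\<close> and
  columns \<open>R\<close>. For the elements of the full switch group this matrix is the exclusive or of a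
  function of the row and a function of the column, and by homogeneity of the random bipartite
  graph a closed group containing all automorphisms is determined by the finite patterns its
  members realise. If \<open>\<sigma> \<in> G\<close> and two rows \<open>u\<close>, \<open>w\<close> of the matrix differ, then they differ in every
  column. Precomposing \<open>\<sigma>\<close> with an automorphism, we may prescribe \<open>u\<close> and choose \<open>w\<close> to have the
  opposite cross-types to \<open>u\<close> over a given finite set \<open>B\<close>; then \<open>\<sigma> u\<close> and \<open>\<sigma> w\<close> have the same type
  over \<open>\<sigma> ` B\<close>, so some automorphism \<open>\<alpha>\<close> moves \<open>\<sigma> u\<close> to \<open>\<sigma> w\<close> and fixes the images of any finitely many
  other vertices. The conjugate of \<open>\<alpha>\<close> by \<open>\<sigma>\<close> is locally a switch with respect to \<open>u\<close>. Hence either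
  \<open>G\<close> contains all switches of a side or the matrices of its elements do not depend on that side,
  and conversely every such matrix is locally a composition of finitely many switches and \<open>\<rho>\<close>.\<close>

section \<open>Back and forth\<close>

text \<open>This is the carrier of \<open>Sym_lr\<close>, written for two bare sets so that the
  sides can be exchanged.\<close>

definition side_perms :: "'a set \<Rightarrow> 'a set \<Rightarrow> ('a \<Rightarrow> 'a) set" where
  "side_perms L R = {\<sigma> \<in> Bij (L \<union> R). \<sigma> ` L = L \<and> \<sigma> ` R = R}"

lemma side_perms_commute: "side_perms L R = side_perms R L"
  unfolding side_perms_def Un_commute[of L R] by (simp only: conj_commute[of "_ ` L = L"])

lemma side_permsD:
  assumes "\<sigma> \<in> side_perms L R"
  shows "x \<in> L \<Longrightarrow> \<sigma> x \<in> L" "x \<in> R \<Longrightarrow> \<sigma> x \<in> R" "inj_on \<sigma> (L \<union> R)" "\<sigma> \<in> Bij (L \<union> R)"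
proof -
  have "\<sigma> ` L = L" "\<sigma> ` R = R" and bij: "\<sigma> \<in> Bij (L \<union> R)" using assms by (simp_all add: side_perms_def)
  then show "x \<in> L \<Longrightarrow> \<sigma> x \<in> L" "x \<in> R \<Longrightarrow> \<sigma> x \<in> R" by (metis imageI)+
  show "inj_on \<sigma> (L \<union> R)" "\<sigma> \<in> Bij (L \<union> R)" using bij by (simp_all add: Bij_def bij_betw_def)
qed

lemma side_perms_inv_into:
  assumes "\<sigma> \<in> side_perms L R" "x \<in> L \<union> R"
  shows "restrict (inv_into (L \<union> R) \<sigma>) (L \<union> R) (\<sigma> x) = x"
proof -
  have "\<sigma> x \<in> L \<union> R" using side_permsD(1,2)[OF assms(1), of x] assms(2) by blast
  then show ?thesis using side_permsD(3)[OF assms(1)] assms(2) by simp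
qed

text \<open>All notions are symmetric in the two sides, so that each statement about \<open>L\<close> also yields
  the one about \<open>R\<close> by exchanging the parameters.\<close>

locale random_bipartite =
  fixes L R :: "'a set" and E :: "'a \<Rightarrow> 'a \<Rightarrow> bool"
  assumes disjoint: "L \<inter> R = {}"
    and countable: "countable L" "countable R"
    and sym: "E x y \<longleftrightarrow> E y x"
    and ext_right: "finite X \<Longrightarrow> finite Y \<Longrightarrow> X \<subseteq> L \<Longrightarrow> Y \<subseteq> L \<Longrightarrow> X \<inter> Y = {} \<Longrightarrow>
      \<exists>v\<in>R. (\<forall>x\<in>X. E x v) \<and> (\<forall>y\<in>Y. \<not> E y v)"
    and ext_left: "finite X \<Longrightarrow> finite Y \<Longrightarrow> X \<subseteq> R \<Longrightarrow> Y \<subseteq> R \<Longrightarrow> X \<inter> Y = {} \<Longrightarrow>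
      \<exists>v\<in>L. (\<forall>x\<in>X. E v x) \<and> (\<forall>y\<in>Y. \<not> E v y)"
begin

lemma dual: "random_bipartite R L E"
proof
  fix X Y :: "'a set"
  assume XY: "finite X" "finite Y" "X \<inter> Y = {}"
  show "\<exists>v\<in>L. (\<forall>x\<in>X. E x v) \<and> (\<forall>y\<in>Y. \<not> E y v)" if "X \<subseteq> R" "Y \<subseteq> R"
    using ext_left[OF XY(1,2) that XY(3)] by (metis sym)
  show "\<exists>v\<in>R. (\<forall>x\<in>X. E v x) \<and> (\<forall>y\<in>Y. \<not> E v y)" if "X \<subseteq> L" "Y \<subseteq> L"
    using ext_right[OF XY(1,2) that XY(3)] by (metis sym)
qed (use disjoint countable sym in auto)

text \<open>If \<open>R\<close> were finite, some \<open>w\<close> in \<open>L\<close> would be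
  adjacent to all of it, yet some vertex of \<open>R\<close> must avoid \<open>w\<close>.\<close>

lemma infinite_right: "infinite R"
proof
  assume "finite R"
  then obtain w where w: "w \<in> L" "\<forall>x\<in>R. E w x"
    using ext_left[of R "{}"] by auto
  then show False using ext_right[of "{}" "{w}"] by auto
qed

text \<open>A vertex \<open>n\<close> is avoided by adding one fresh vertex \<open>b\<close> of
  \<open>R\<close> to the requirements and asking for the adjacency to \<open>b\<close> that
  \<open>n\<close> does not have. A fresh \<open>b\<close> exists because \<open>R\<close> is
  infinite.\<close>

lemma ext_left_avoiding:
  assumes "finite N" "finite X" "X \<subseteq> R"
  shows "\<exists>v\<in>L - N. \<forall>x\<in>X. E v x \<longleftrightarrow> c x"
  using assms
proof (induction N arbitrary: X c rule: finite_induct)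
  case empty
  have "\<exists>v\<in>L. (\<forall>x\<in>{x\<in>X. c x}. E v x) \<and> (\<forall>y\<in>{x\<in>X. \<not> c x}. \<not> E v y)"
    using empty by (intro ext_left) auto
  then show ?case by auto
next
  case (insert n N)
  obtain b where b: "b \<in> R" "b \<notin> X"
    using infinite_right insert.prems(1) by (meson finite_subset subsetI)
  obtain v where v: "v \<in> L - N" "\<forall>x\<in>insert b X. E v x \<longleftrightarrow> (if x = b then \<not> E n b else c x)"
    using insert.IH[of "insert b X" "\<lambda>x. if x = b then \<not> E n b else c x"] insert.prems b by auto
  have "v \<noteq> n" using v(2) by auto
  moreover have "\<forall>x\<in>X. E v x \<longleftrightarrow> c x" using v(2) b(2) by auto
  ultimately show ?case using v(1) by blast
qed

end

section \<open>Finite partial isomorphisms and their extension to all vertices\<close>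

text \<open>Two relations are kept apart because a switch will be obtained as an isomorphism from a
  modified graph to the original one.\<close>

definition partial_iso ::
  "'a set \<Rightarrow> 'a set \<Rightarrow> ('a \<Rightarrow> 'a \<Rightarrow> bool) \<Rightarrow> ('a \<Rightarrow> 'a \<Rightarrow> bool) \<Rightarrow> ('a \<times> 'a) set \<Rightarrow> bool" where
  "partial_iso L R E E' p \<longleftrightarrow> finite p \<and> p \<subseteq> L \<times> L \<union> R \<times> R \<and>
     (\<forall>(x, y)\<in>p. \<forall>(x', y')\<in>p. (x = x' \<longleftrightarrow> y = y') \<and> (x \<in> L \<and> x' \<in> R \<longrightarrow> E x x' = E' y y'))"

lemma partial_isoD:
  assumes "partial_iso L R E E' p" "(x, y) \<in> p" "(x', y') \<in> p"
  shows "x = x' \<longleftrightarrow> y = y'" "x \<in> L \<Longrightarrow> x' \<in> R \<Longrightarrow> E x x' = E' y y'"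
  using assms unfolding partial_iso_def by fast+

lemma partial_iso_swap:
  assumes "random_bipartite L R E" "random_bipartite L R E'" "partial_iso L R E E' p"
  shows "partial_iso R L E E' p"
proof -
  have "E x x' = E' y y'" if "(x, y) \<in> p" "(x', y') \<in> p" "x \<in> R" "x' \<in> L" for x y x' y'
  proof -
    have "E x' x = E' y' y" using that assms(3) unfolding partial_iso_def by fast
    then show ?thesis using assms(1,2) random_bipartite.sym by metis
  qed
  with assms(3) show ?thesis unfolding partial_iso_def by fast
qed

lemma partial_iso_converse:
  assumes "L \<inter> R = {}" "partial_iso L R E E' p"
  shows "partial_iso L R E' E (p\<inverse>)"
  unfolding partial_iso_def
proof (intro conjI)
  show "finite (p\<inverse>)" using assms(2) by (simp add: partial_iso_def)
  show "p\<inverse> \<subseteq> L \<times> L \<union> R \<times> R" using assms(2) unfolding partial_iso_def by blast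
  have "(x = x') = (y = y') \<and> (x \<in> L \<and> x' \<in> R \<longrightarrow> E' x x' = E y y')"
    if "(y, x) \<in> p" "(y', x') \<in> p" for x x' y y'
  proof -
    have "x \<in> L \<Longrightarrow> y \<in> L" "x' \<in> R \<Longrightarrow> y' \<in> R"
      using that assms unfolding partial_iso_def by blast+
    moreover have "(y = y' \<longleftrightarrow> x = x') \<and> (y \<in> L \<and> y' \<in> R \<longrightarrow> E y y' = E' x x')"
      using that assms unfolding partial_iso_def by fast
    ultimately show ?thesis by auto
  qed
  then show "\<forall>(x, y)\<in>p\<inverse>. \<forall>(x', y')\<in>p\<inverse>. (x = x') = (y = y') \<and> (x \<in> L \<and> x' \<in> R \<longrightarrow> E' x x' = E y y')"
    by blast
qed

lemma partial_iso_forth_left: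
  assumes "random_bipartite L R E" "random_bipartite L R E'" "partial_iso L R E E' p" "x \<in> L"
  shows "\<exists>y. partial_iso L R E E' (insert (x, y) p)"
proof (cases "x \<in> Domain p")
  case True
  then show ?thesis using assms(3) by (metis DomainE insert_absorb)
next
  case False
  interpret E': random_bipartite L R E' by fact
  note inj = partial_isoD(1)[OF assms(3)] and iso = partial_isoD(2)[OF assms(3)]
  have p: "finite p" "p \<subseteq> L \<times> L \<union> R \<times> R" using assms(3) by (auto simp: partial_iso_def)
  have fin: "finite (Range p)" using p(1) by (rule finite_Range)
  \<comment> \<open>The adjacency that the image of \<open>x\<close> must have to \<open>y\<close>,
    read off at the preimage of \<open>y\<close> under \<open>p\<close>; this preimage is unique
    because \<open>p\<close> is injective.\<close>
  define c where "c y = E x (THE x'. (x', y) \<in> p)" for y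
  have c: "c y' = E x x'" if "(x', y') \<in> p" for x' y'
    unfolding c_def using that inj by (intro arg_cong[where f = "E x"] the_equality) auto
  obtain y where y: "y \<in> L - Range p" "\<forall>y'\<in>Range p \<inter> R. E' y y' \<longleftrightarrow> c y'"
    using E'.ext_left_avoiding[of "Range p" "Range p \<inter> R" c] fin by auto
  have *: "E x x' = E' y y'" if "(x', y') \<in> p" "x' \<in> R" for x' y'
  proof -
    have "y' \<in> R" using that p(2) E'.disjoint by blast
    then show ?thesis using c[OF that(1)] y(2) that(1) by blast
  qed
  have "(u = u') = (v = v') \<and> (u \<in> L \<and> u' \<in> R \<longrightarrow> E u u' = E' v v')"
    if "(u, v) \<in> insert (x, y) p" "(u', v') \<in> insert (x, y) p" for u v u' v'
  proof -
    have "u \<noteq> x \<and> v \<noteq> y" if "(u, v) \<in> p" for u v using that False y(1) by blast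
    moreover have "x \<notin> R" using assms(4) E'.disjoint by blast
    ultimately show ?thesis using that inj[of u v u' v'] iso[of u v u' v'] *[of u' v'] by auto
  qed
  then have "partial_iso L R E E' (insert (x, y) p)"
    unfolding partial_iso_def using p y(1) assms(4) by blast
  then show ?thesis by blast
qed

lemma partial_iso_forth:
  assumes "random_bipartite L R E" "random_bipartite L R E'" "partial_iso L R E E' p" "x \<in> L \<union> R"
  shows "\<exists>y. partial_iso L R E E' (insert (x, y) p)"
proof (cases "x \<in> L")
  case True
  with assms show ?thesis by (simp add: partial_iso_forth_left)
next
  case False
  then have x: "x \<in> R" using assms(4) by blast
  have d: "random_bipartite R L E" "random_bipartite R L E'"
    using assms random_bipartite.dual by blast+
  obtain y where "partial_iso R L E E' (insert (x, y) p)"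
    using partial_iso_forth_left[OF d partial_iso_swap[OF assms(1-3)] x] by blast
  then show ?thesis using partial_iso_swap[OF d] by blast
qed

text \<open>The back step is the forth step for the converse relation, with the two graphs
  exchanged.\<close>

lemma partial_iso_back_and_forth:
  assumes "random_bipartite L R E" "random_bipartite L R E'" "partial_iso L R E E' p" "z \<in> L \<union> R"
  shows "\<exists>q. partial_iso L R E E' q \<and> p \<subseteq> q \<and> z \<in> Domain q \<and> z \<in> Range q"
proof -
  have dj: "L \<inter> R = {}" using assms(1) by (rule random_bipartite.disjoint)
  obtain y where y: "partial_iso L R E E' (insert (z, y) p)"
    using partial_iso_forth[OF assms] by blast
  then have "partial_iso L R E' E ((insert (z, y) p)\<inverse>)"
    by (rule partial_iso_converse[OF dj])
  then obtain x where "partial_iso L R E' E (insert (z, x) ((insert (z, y) p)\<inverse>))"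
    using partial_iso_forth[OF assms(2,1) _ assms(4)] by blast
  then have "partial_iso L R E E' ((insert (z, x) ((insert (z, y) p)\<inverse>))\<inverse>)"
    by (rule partial_iso_converse[OF dj])
  then show ?thesis by (intro exI conjI) (assumption, auto)
qed

text \<open>Cantor's back-and-forth argument: along an enumeration \<open>e\<close> of the vertices,
  stage \<open>n\<close> puts \<open>e n\<close> into both domain and range, and the union of the
  stages is the graph of the required permutation.\<close>

lemma partial_iso_extends:
  assumes "random_bipartite L R E" "random_bipartite L R E'" "partial_iso L R E E' p"
  shows "\<exists>\<sigma>\<in>side_perms L R. (\<forall>(x, y)\<in>p. \<sigma> x = y) \<and> (\<forall>a\<in>L. \<forall>b\<in>R. E a b = E' (\<sigma> a) (\<sigma> b))"
proof -
  interpret random_bipartite L R E by fact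
  let ?V = "L \<union> R"
  have ne: "?V \<noteq> {}" using infinite_right by auto
  define e where "e = from_nat_into ?V"
  have e: "e n \<in> ?V" for n unfolding e_def using ne by (rule from_nat_into)
  have surj: "\<exists>n. e n = x" if "x \<in> ?V" for x
    unfolding e_def using that countable by (intro from_nat_into_surj) auto
  \<comment> \<open>The conjunct for \<open>n = 0\<close> makes the chain start at \<open>p\<close>,
    so that the union extends \<open>p\<close>.\<close>
  have "\<exists>q. \<forall>n. (partial_iso L R E E' (q n) \<and> (n = 0 \<longrightarrow> q n = p)) \<and>
      (q n \<subseteq> q (Suc n) \<and> e n \<in> Domain (q (Suc n)) \<and> e n \<in> Range (q (Suc n)))"
  proof (rule dependent_nat_choice)
    show "\<exists>x. partial_iso L R E E' x \<and> (0 = (0::nat) \<longrightarrow> x = p)" using assms(3) by blast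
  next
    fix x and n :: nat
    assume "partial_iso L R E E' x \<and> (n = 0 \<longrightarrow> x = p)"
    then show "\<exists>y. (partial_iso L R E E' y \<and> (Suc n = 0 \<longrightarrow> y = p)) \<and>
        x \<subseteq> y \<and> e n \<in> Domain y \<and> e n \<in> Range y"
      using partial_iso_back_and_forth[OF assms(1,2) _ e[of n], of x] by auto
  qed
  then obtain q where q: "\<And>n. partial_iso L R E E' (q n)" "q 0 = p"
      "\<And>n. q n \<subseteq> q (Suc n)" "\<And>n. e n \<in> Domain (q (Suc n))" "\<And>n. e n \<in> Range (q (Suc n))"
    by metis
  have mono: "q m \<subseteq> q n" if "m \<le> n" for m n
    using q(3) that by (rule lift_Suc_mono_le)
  define g where "g = (\<Union>n. q n)"
  \<comment> \<open>Injectivity and preservation of adjacency concern two pairs at a time, and two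
    pairs of the union already lie in a common stage.\<close>
  have joint: "\<exists>n. {u, v} \<subseteq> q n" if "u \<in> g" "v \<in> g" for u v
  proof -
    from that obtain m n where "u \<in> q m" "v \<in> q n" unfolding g_def by blast
    then show ?thesis using mono[of m "max m n"] mono[of n "max m n"] by auto
  qed
  have sub: "g \<subseteq> L \<times> L \<union> R \<times> R" using q(1) unfolding g_def partial_iso_def by blast
  have inj: "x = x' \<longleftrightarrow> y = y'" if "(x, y) \<in> g" "(x', y') \<in> g" for x y x' y'
  proof -
    from joint[OF that] obtain n where "(x, y) \<in> q n" "(x', y') \<in> q n" by blast
    then show ?thesis by (rule partial_isoD(1)[OF q(1)])
  qed
  have iso: "E x x' = E' y y'" if "(x, y) \<in> g" "(x', y') \<in> g" "x \<in> L" "x' \<in> R" for x y x' y'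
  proof -
    from joint[OF that(1,2)] obtain n where "(x, y) \<in> q n" "(x', y') \<in> q n" by blast
    then show ?thesis using that(3,4) by (rule partial_isoD(2)[OF q(1)])
  qed
  have dom: "\<exists>y. (x, y) \<in> g" if "x \<in> ?V" for x
    using surj[OF that] q(4) unfolding g_def by blast
  have ran: "\<exists>x. (x, y) \<in> g" if "y \<in> ?V" for y
    using surj[OF that] q(5) unfolding g_def by blast
  define \<sigma> where "\<sigma> = (\<lambda>x\<in>?V. THE y. (x, y) \<in> g)"
  have \<sigma>: "\<sigma> x = y" if "(x, y) \<in> g" for x y
  proof -
    have "(THE y. (x, y) \<in> g) = y" using that inj by (intro the_equality) auto
    moreover have "x \<in> ?V" using that sub by auto
    ultimately show ?thesis by (simp add: \<sigma>_def)
  qed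
  have \<sigma>g: "(x, \<sigma> x) \<in> g" if "x \<in> ?V" for x
    using dom[OF that] \<sigma> by auto
  have side: "\<sigma> ` A = A" if "A = L \<or> A = R" for A
  proof
    show "\<sigma> ` A \<subseteq> A" using \<sigma>g sub disjoint that by blast
    show "A \<subseteq> \<sigma> ` A"
    proof
      fix y assume y: "y \<in> A"
      with that ran obtain x where x: "(x, y) \<in> g" by blast
      then have "x \<in> A" using y that sub disjoint by blast
      then show "y \<in> \<sigma> ` A" using \<sigma>[OF x] by blast
    qed
  qed
  have "inj_on \<sigma> ?V" by (rule inj_onI) (metis \<sigma>g inj)
  moreover have "\<sigma> \<in> extensional ?V" by (simp add: \<sigma>_def)
  ultimately have "\<sigma> \<in> side_perms L R"
    by (simp add: side_perms_def Bij_def bij_betw_def image_Un side)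
  moreover have "p \<subseteq> g" using q(2) by (auto simp: g_def)
  ultimately show ?thesis using \<sigma> \<sigma>g iso by (intro bexI[of _ \<sigma>]) auto
qed


section \<open>Permutations and the cross-types they change\<close>

context random_bipartite
begin

definition flips :: "('a \<Rightarrow> 'a) \<Rightarrow> 'a \<Rightarrow> 'a \<Rightarrow> bool" where
  "flips \<sigma> a b \<longleftrightarrow> E a b \<noteq> E (\<sigma> a) (\<sigma> b)"

definition automorphisms :: "('a \<Rightarrow> 'a) set" where
  "automorphisms = {\<sigma> \<in> side_perms L R. \<forall>a\<in>L. \<forall>b\<in>R. \<not> flips \<sigma> a b}"

text \<open>Equivalently, \<open>flips \<sigma> a b\<close> is the exclusive or of a function of \<open>a\<close> and a function
  of \<open>b\<close>.\<close>

definition rectangular :: "('a \<Rightarrow> 'a) \<Rightarrow> bool" where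
  "rectangular \<sigma> \<longleftrightarrow> (\<forall>a\<in>L. \<forall>a'\<in>L. \<forall>b\<in>R. \<forall>b'\<in>R.
     (flips \<sigma> a b = flips \<sigma> a' b) = (flips \<sigma> a b' = flips \<sigma> a' b'))"

lemma flips_commute: "flips \<sigma> a b = flips \<sigma> b a"
  using sym by (auto simp: flips_def)

lemma automorphisms_dual: "random_bipartite.automorphisms R L E = automorphisms"
proof -
  have "(\<forall>a\<in>R. \<forall>b\<in>L. \<not> flips \<sigma> a b) \<longleftrightarrow> (\<forall>a\<in>L. \<forall>b\<in>R. \<not> flips \<sigma> a b)" for \<sigma>
    using flips_commute[of \<sigma>] by metis
  then show ?thesis
    unfolding random_bipartite.automorphisms_def[OF dual] automorphisms_def
      side_perms_commute[of R L] by simp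
qed

text \<open>Each instance says that a 2 by 2 submatrix has an even number of true entries, which is
  invariant under transposition.\<close>

lemma rectangular_dual: "random_bipartite.rectangular R L E = rectangular"
proof
  fix \<sigma>
  let ?f = "flips \<sigma>"
  have transpose: "(p = r) = (q = s)" if "(p = q) = (r = s)" for p q r s :: bool
    using that by blast
  have "random_bipartite.rectangular R L E \<sigma> \<longleftrightarrow>
      (\<forall>b\<in>R. \<forall>b'\<in>R. \<forall>a\<in>L. \<forall>a'\<in>L. (?f a b = ?f a b') = (?f a' b = ?f a' b'))"
    unfolding random_bipartite.rectangular_def[OF dual]
    by (simp only: flips_commute[of \<sigma> b a for a b])
  also have "\<dots> \<longleftrightarrow> rectangular \<sigma>"
    (is "?lhs \<longleftrightarrow> _")
  proof
    assume h: ?lhs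
    show "rectangular \<sigma>"
      unfolding rectangular_def by (intro ballI, rule transpose, rule h[rule_format])
  next
    assume h: "rectangular \<sigma>"
    show ?lhs
      by (intro ballI, rule transpose, rule h[unfolded rectangular_def, rule_format])
  qed
  finally show "random_bipartite.rectangular R L E \<sigma> = rectangular \<sigma>" .
qed

lemma flips_compose:
  assumes "a \<in> L \<union> R" "b \<in> L \<union> R"
  shows "flips (compose (L \<union> R) \<tau> \<sigma>) a b \<longleftrightarrow> flips \<sigma> a b \<noteq> flips \<tau> (\<sigma> a) (\<sigma> b)"
  using assms by (auto simp: flips_def compose_def)

text \<open>Homogeneity in parametrised form: the finite partial isomorphism is the set of pairs
  \<open>(h x, k x)\<close>. This suits the applications, where \<open>h\<close> and
  \<open>k\<close> are known maps on a common finite set.\<close>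

lemma homogeneous:
  assumes "finite S" "S \<subseteq> L \<union> R" "inj_on h S" "inj_on k S"
    and "\<And>x. x \<in> S \<Longrightarrow> x \<in> L \<Longrightarrow> h x \<in> L \<and> k x \<in> L"
    and "\<And>x. x \<in> S \<Longrightarrow> x \<in> R \<Longrightarrow> h x \<in> R \<and> k x \<in> R"
    and "\<And>a b. a \<in> S \<Longrightarrow> b \<in> S \<Longrightarrow> a \<in> L \<Longrightarrow> b \<in> R \<Longrightarrow> E (h a) (h b) = E (k a) (k b)"
  shows "\<exists>\<alpha>\<in>automorphisms. \<forall>x\<in>S. \<alpha> (h x) = k x"
proof -
  have sides: "x \<in> L \<longleftrightarrow> h x \<in> L" "x \<in> R \<longleftrightarrow> h x \<in> R" if "x \<in> S" for x
    using that assms(2,5,6) disjoint by blast+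
  have "partial_iso L R E E ((\<lambda>x. (h x, k x)) ` S)"
    unfolding partial_iso_def
  proof (intro conjI)
    show "(\<lambda>x. (h x, k x)) ` S \<subseteq> L \<times> L \<union> R \<times> R" using assms by blast
    show "\<forall>(x, y)\<in>(\<lambda>x. (h x, k x)) ` S. \<forall>(x', y')\<in>(\<lambda>x. (h x, k x)) ` S.
        (x = x') = (y = y') \<and> (x \<in> L \<and> x' \<in> R \<longrightarrow> E x x' = E y y')"
      using assms(3,4,7) sides by (auto simp: inj_on_eq_iff)
  qed (use assms in simp)
  from partial_iso_extends[OF random_bipartite_axioms random_bipartite_axioms this]
  obtain \<alpha> where "\<alpha> \<in> side_perms L R" "\<forall>x\<in>S. \<alpha> (h x) = k x"
    "\<forall>a\<in>L. \<forall>b\<in>R. E a b = E (\<alpha> a) (\<alpha> b)" by auto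
  then show ?thesis by (intro bexI[of _ \<alpha>]) (auto simp: automorphisms_def flips_def)
qed

text \<open>Inverting all adjacencies at \<open>v\<close> yields a graph that again has the
  extension properties. An isomorphism from it to the original graph is a switch with respect to
  \<open>v\<close>.\<close>

lemma switch_exists_left:
  assumes "v \<in> L"
  shows "\<exists>\<sigma>\<in>side_perms L R. \<forall>a\<in>L. \<forall>b\<in>R. flips \<sigma> a b \<longleftrightarrow> a = v"
proof -
  define E' where "E' x y \<longleftrightarrow> E x y \<noteq> (x = v \<or> y = v)" for x y
  interpret dual: random_bipartite R L E by (rule dual)
  have "random_bipartite L R E'"
  proof
    show "E' x y = E' y x" for x y unfolding E'_def using sym by auto
  next
    fix X Y assume XY: "finite X" "finite Y" "X \<subseteq> L" "Y \<subseteq> L" "X \<inter> Y = {}"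
    \<comment> \<open>The adjacency demanded in \<open>E\<close> is inverted at \<open>v\<close>,
      because passing to \<open>E'\<close> inverts it once more.\<close>
    obtain b where b: "b \<in> R" "\<forall>x\<in>X \<union> Y. E b x \<longleftrightarrow> (x \<in> X) \<noteq> (x = v)"
      using dual.ext_left_avoiding[of "{}" "X \<union> Y" "\<lambda>x. (x \<in> X) \<noteq> (x = v)"] XY by auto
    have "b \<noteq> v" using b(1) assms disjoint by auto
    have "\<forall>x\<in>X \<union> Y. E' x b \<longleftrightarrow> x \<in> X" unfolding E'_def using b(2) \<open>b \<noteq> v\<close> sym by blast
    then show "\<exists>b\<in>R. (\<forall>x\<in>X. E' x b) \<and> (\<forall>y\<in>Y. \<not> E' y b)" using XY(5) b(1) by blast
  next
    fix X Y assume XY: "finite X" "finite Y" "X \<subseteq> R" "Y \<subseteq> R" "X \<inter> Y = {}"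
    \<comment> \<open>Choosing \<open>a\<close> different from \<open>v\<close> makes
      \<open>E\<close> and \<open>E'\<close> agree between \<open>a\<close> and
      \<open>R\<close>.\<close>
    obtain a where a: "a \<in> L - {v}" "\<forall>x\<in>X \<union> Y. E a x \<longleftrightarrow> x \<in> X"
      using ext_left_avoiding[of "{v}" "X \<union> Y" "\<lambda>x. x \<in> X"] XY by auto
    have "v \<notin> X \<union> Y" using XY assms disjoint by blast
    then have "\<forall>x\<in>X \<union> Y. E' a x \<longleftrightarrow> x \<in> X" unfolding E'_def using a by blast
    then show "\<exists>a\<in>L. (\<forall>x\<in>X. E' a x) \<and> (\<forall>y\<in>Y. \<not> E' a y)" using XY(5) a(1) by blast
  qed (use disjoint countable in auto)
  moreover have "partial_iso L R E' E {}" by (simp add: partial_iso_def)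
  ultimately obtain \<sigma> where "\<sigma> \<in> side_perms L R" "\<forall>a\<in>L. \<forall>b\<in>R. E' a b = E (\<sigma> a) (\<sigma> b)"
    using partial_iso_extends random_bipartite_axioms by blast
  moreover have "b \<noteq> v" if "b \<in> R" for b using that assms disjoint by blast
  ultimately show ?thesis by (intro bexI[of _ \<sigma>]) (auto simp: flips_def E'_def)
qed

lemma switch_exists:
  assumes "v \<in> L \<union> R"
  shows "\<exists>\<sigma>\<in>side_perms L R. \<forall>a\<in>L. \<forall>b\<in>R. flips \<sigma> a b \<longleftrightarrow> a = v \<or> b = v"
proof (cases "v \<in> L")
  case True
  then show ?thesis using switch_exists_left[OF True] disjoint by blast
next
  case False
  then have "v \<in> R" using assms by blast
  from random_bipartite.switch_exists_left[OF dual this]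
  show ?thesis unfolding side_perms_commute[of R L] using False flips_commute by metis
qed

end

section \<open>Closed groups containing all automorphisms\<close>

text \<open>The assumption \<open>closed\<close> is closedness under pointwise convergence,
  expressed by approximation on finite sets.\<close>

locale closed_group = random_bipartite +
  fixes H :: "('a \<Rightarrow> 'a) set"
  assumes sub_perms: "H \<subseteq> side_perms L R"
    and mult: "\<sigma> \<in> H \<Longrightarrow> \<tau> \<in> H \<Longrightarrow> compose (L \<union> R) \<sigma> \<tau> \<in> H"
    and inverse: "\<sigma> \<in> H \<Longrightarrow> restrict (inv_into (L \<union> R) \<sigma>) (L \<union> R) \<in> H"
    and closed: "\<sigma> \<in> side_perms L R \<Longrightarrow>
      (\<And>S. finite S \<Longrightarrow> S \<subseteq> L \<union> R \<Longrightarrow> \<exists>\<eta>\<in>H. \<forall>x\<in>S. \<eta> x = \<sigma> x) \<Longrightarrow> \<sigma> \<in> H"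
    and automorphisms_subset: "automorphisms \<subseteq> H"
begin

lemma dual_closed_group: "closed_group R L E H"
proof -
  interpret dual: random_bipartite R L E by (rule dual)
  show ?thesis
    using sub_perms mult inverse closed automorphisms_subset
    by unfold_locales (simp_all add: side_perms_commute[of R L] Un_commute[of R] automorphisms_dual)
qed

text \<open>By homogeneity, membership depends only on which cross-types a permutation changes
  locally.\<close>

lemma mem_if_flips_agree:
  assumes "\<sigma> \<in> side_perms L R"
    and "\<And>A B. finite A \<Longrightarrow> finite B \<Longrightarrow> A \<subseteq> L \<Longrightarrow> B \<subseteq> R \<Longrightarrow>
      \<exists>\<eta>\<in>H. \<forall>a\<in>A. \<forall>b\<in>B. flips \<eta> a b = flips \<sigma> a b"
  shows "\<sigma> \<in> H"
proof (rule closed[OF assms(1)])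
  fix S assume S: "finite S" "S \<subseteq> L \<union> R"
  obtain \<eta> where \<eta>: "\<eta> \<in> H" "\<forall>a\<in>S \<inter> L. \<forall>b\<in>S \<inter> R. flips \<eta> a b = flips \<sigma> a b"
    using assms(2)[of "S \<inter> L" "S \<inter> R"] S by auto
  have \<eta>p: "\<eta> \<in> side_perms L R" using \<eta> sub_perms by blast
  \<comment> \<open>As \<open>\<eta>\<close> and \<open>\<sigma>\<close> flip the same cross-edges
    within \<open>S\<close>, sending \<open>\<eta> x\<close> to \<open>\<sigma> x\<close> preserves
    adjacency.\<close>
  have "\<exists>\<alpha>\<in>automorphisms. \<forall>x\<in>S. \<alpha> (\<eta> x) = \<sigma> x"
  proof (rule homogeneous)
    show "inj_on \<eta> S" "inj_on \<sigma> S"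
      using side_permsD(3)[OF \<eta>p] side_permsD(3)[OF assms(1)] S(2) by (auto intro: inj_on_subset)
  qed (use S \<eta> side_permsD[OF \<eta>p] side_permsD[OF assms(1)] in \<open>auto simp: flips_def\<close>)
  then obtain \<alpha> where \<alpha>: "\<alpha> \<in> automorphisms" "\<forall>x\<in>S. \<alpha> (\<eta> x) = \<sigma> x" by blast
  have "compose (L \<union> R) \<alpha> \<eta> \<in> H" using \<alpha>(1) \<eta>(1) automorphisms_subset mult by blast
  moreover have "\<forall>x\<in>S. compose (L \<union> R) \<alpha> \<eta> x = \<sigma> x" using S(2) \<alpha>(2) by (auto simp: compose_def)
  ultimately show "\<exists>\<eta>\<in>H. \<forall>x\<in>S. \<eta> x = \<sigma> x" by blast
qed

text \<open>By rectangularity a difference of two rows in one column persists in all columns, and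
  homogeneity lets it be placed at any vertex \<open>u\<close>. A conjugated automorphism then
  imitates the switch at \<open>u\<close> on any finite set.\<close>

lemma switch_mem_if_nonconstant:
  assumes "\<sigma> \<in> H" "rectangular \<sigma>"
    and "u0 \<in> L" "u1 \<in> L" "b0 \<in> R" "flips \<sigma> u0 b0 \<noteq> flips \<sigma> u1 b0"
    and "s \<in> side_perms L R" "u \<in> L" "\<forall>a\<in>L. \<forall>b\<in>R. flips s a b \<longleftrightarrow> a = u"
  shows "s \<in> H"
proof (rule mem_if_flips_agree[OF assms(7)])
  fix A B assume AB: "finite A" "finite B" "A \<subseteq> L" "B \<subseteq> R"
  \<comment> \<open>Over \<open>B\<close> the vertex \<open>w\<close> looks like \<open>u\<close>
    after the switch; lying outside \<open>A\<close>, it cannot collide with the vertices to be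
    fixed.\<close>
  obtain w where w: "w \<in> L - insert u A" "\<forall>b\<in>B. E w b \<longleftrightarrow> \<not> E u b"
    using ext_left_avoiding[of "insert u A" B "\<lambda>b. \<not> E u b"] AB by auto
  \<comment> \<open>Both vertices lie in \<open>L\<close>, so no cross-edge constrains where the
    pair is sent.\<close>
  have "\<exists>\<beta>\<in>automorphisms. \<forall>x\<in>{u, w}. \<beta> (id x) = (if x = u then u0 else u1)"
    using assms w disjoint by (intro homogeneous) (auto simp: inj_on_def)
  then obtain \<beta> where \<beta>: "\<beta> \<in> automorphisms" "\<beta> u = u0" "\<beta> w = u1" using w by auto
  have \<beta>p: "\<beta> \<in> side_perms L R" and \<beta>f: "\<And>a b. a \<in> L \<Longrightarrow> b \<in> R \<Longrightarrow> \<not> flips \<beta> a b"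
    using \<beta>(1) by (auto simp: automorphisms_def)
  define \<phi> where "\<phi> = compose (L \<union> R) \<sigma> \<beta>"
  have \<phi>H: "\<phi> \<in> H" unfolding \<phi>_def using \<beta>(1) assms(1) automorphisms_subset mult by blast
  then have \<phi>p: "\<phi> \<in> side_perms L R" using sub_perms by blast
  have \<phi>f: "flips \<phi> u b \<noteq> flips \<phi> w b" if "b \<in> R" for b
  proof -
    have "\<beta> b \<in> R" using side_permsD[OF \<beta>p] that by blast
    then have "flips \<sigma> u0 (\<beta> b) \<noteq> flips \<sigma> u1 (\<beta> b)"
      using assms(2-6) unfolding rectangular_def by metis
    then show ?thesis
      unfolding \<phi>_def using that w assms(8) \<beta>f \<beta> by (simp add: flips_compose)
  qed
  \<comment> \<open>The adjacencies of \<open>u\<close> and \<open>w\<close> to \<open>b\<close> are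
    opposite and exactly one of them is flipped by \<open>\<phi>\<close>, so those of the images
    coincide.\<close>
  have Ew: "E (\<phi> u) (\<phi> b) = E (\<phi> w) (\<phi> b)" if "b \<in> B" for b
    using \<phi>f[of b] w(2) that AB(4) unfolding flips_def by blast
  \<comment> \<open>Replacing \<open>u\<close> by \<open>w\<close> is injective on \<open>?S\<close>
    because \<open>w\<close> lies outside \<open>?S\<close>; by \<open>Ew\<close> it preserves
    adjacency between the images under \<open>\<phi>\<close>.\<close>
  let ?S = "insert u A \<union> B" and ?m = "\<lambda>x. if x = u then w else x"
  have uR: "u \<notin> R" using assms(8) disjoint by blast
  have "\<exists>\<alpha>\<in>automorphisms. \<forall>x\<in>?S. \<alpha> (\<phi> x) = \<phi> (?m x)"
  proof (rule homogeneous)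
    have "inj_on ?m ?S" using w AB disjoint by (auto simp: inj_on_def)
    moreover have "inj_on \<phi> (?m ` ?S)"
      using side_permsD(3)[OF \<phi>p] by (rule inj_on_subset) (use AB w assms(8) in auto)
    ultimately have "inj_on (\<phi> \<circ> ?m) ?S" by (rule comp_inj_on)
    then show "inj_on (\<lambda>x. \<phi> (?m x)) ?S" by (simp add: comp_def)
    show "inj_on \<phi> ?S"
      using side_permsD(3)[OF \<phi>p] by (rule inj_on_subset) (use AB assms(8) in auto)
  next
    fix a b assume ab: "a \<in> ?S" "b \<in> ?S" "a \<in> L" "b \<in> R"
    then have "b \<in> B" "b \<noteq> u" using AB disjoint uR by auto
    then show "E (\<phi> a) (\<phi> b) = E (\<phi> (?m a)) (\<phi> (?m b))" using Ew by auto
  qed (use AB w assms(8) uR side_permsD[OF \<phi>p] in auto)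
  then obtain \<alpha> where \<alpha>: "\<alpha> \<in> automorphisms" "\<forall>x\<in>?S. \<alpha> (\<phi> x) = \<phi> (?m x)" by blast
  define \<psi> where "\<psi> = restrict (inv_into (L \<union> R) \<phi>) (L \<union> R)"
  \<comment> \<open>This conjugate of \<open>\<alpha>\<close> acts on \<open>?S\<close> as
    \<open>?m\<close>. It moves \<open>u\<close> to a vertex of opposite type over \<open>B\<close>
    and fixes the rest of \<open>?S\<close>, so there it flips exactly the cross-edges at
    \<open>u\<close>.\<close>
  define \<tau> where "\<tau> = compose (L \<union> R) \<psi> (compose (L \<union> R) \<alpha> \<phi>)"
  have "\<tau> \<in> H"
    unfolding \<tau>_def \<psi>_def using \<phi>H \<alpha>(1) automorphisms_subset mult inverse by blast
  have \<tau>: "\<tau> x = ?m x" if "x \<in> ?S" for x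
  proof -
    have xV: "x \<in> L \<union> R" "?m x \<in> L \<union> R" using that AB assms(8) w by auto
    have "\<tau> x = \<psi> (\<alpha> (\<phi> x))" using xV(1) by (simp add: \<tau>_def compose_def)
    also have "\<dots> = \<psi> (\<phi> (?m x))" using bspec[OF \<alpha>(2) that] by (rule arg_cong)
    also have "\<dots> = ?m x" unfolding \<psi>_def by (rule side_perms_inv_into[OF \<phi>p xV(2)])
    finally show ?thesis .
  qed
  have "flips \<tau> a b = flips s a b" if "a \<in> A" "b \<in> B" for a b
  proof -
    have "b \<noteq> u" using that AB uR by auto
    then have "flips \<tau> a b \<longleftrightarrow> a = u" using \<tau>[of a] \<tau>[of b] that w(2) by (auto simp: flips_def)
    then show ?thesis using assms(9) that AB by blast
  qed
  with \<open>\<tau> \<in> H\<close> show "\<exists>\<eta>\<in>H. \<forall>a\<in>A. \<forall>b\<in>B. flips \<eta> a b = flips s a b" by blast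
qed

text \<open>\<open>Z\<close> stands for the union of the sides that may be switched. Switching the
  vertices of \<open>F\<close> one after another flips a cross-edge once for each endpoint in
  \<open>F\<close>, so two such endpoints cancel.\<close>

lemma finite_switch_mem:
  assumes "\<And>\<sigma> v. \<sigma> \<in> side_perms L R \<Longrightarrow> v \<in> Z \<Longrightarrow>
      \<forall>a\<in>L. \<forall>b\<in>R. flips \<sigma> a b \<longleftrightarrow> a = v \<or> b = v \<Longrightarrow> \<sigma> \<in> H"
    and "Z \<subseteq> L \<union> R" "\<And>\<eta> v. \<eta> \<in> side_perms L R \<Longrightarrow> v \<in> Z \<Longrightarrow> \<eta> v \<in> Z"
    and "finite F" "F \<subseteq> Z"
  shows "\<exists>\<eta>\<in>H. \<forall>a\<in>L. \<forall>b\<in>R. flips \<eta> a b \<longleftrightarrow> (a \<in> F) \<noteq> (b \<in> F)"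
  using assms(4,5)
proof (induction rule: finite_induct)
  case empty
  \<comment> \<open>Homogeneity for the empty set merely supplies some automorphism, which flips
    nothing.\<close>
  have "\<exists>\<alpha>\<in>automorphisms. \<forall>x\<in>{}. \<alpha> (id x) = id x" by (rule homogeneous) auto
  then show ?case using automorphisms_subset by (auto simp: automorphisms_def)
next
  case (insert v F)
  then obtain \<eta> where \<eta>: "\<eta> \<in> H" "\<forall>a\<in>L. \<forall>b\<in>R. flips \<eta> a b \<longleftrightarrow> (a \<in> F) \<noteq> (b \<in> F)" by auto
  have \<eta>p: "\<eta> \<in> side_perms L R" using \<eta> sub_perms by blast
  have vV: "v \<in> L \<union> R" using insert.prems assms(2) by blast
  have vZ: "\<eta> v \<in> Z" using assms(3)[OF \<eta>p] insert.prems by blast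
  \<comment> \<open>The switch is applied after \<open>\<eta>\<close>, so it must be taken at
    \<open>\<eta> v\<close>; invariance of \<open>Z\<close> keeps this vertex admissible.\<close>
  obtain s where s: "s \<in> side_perms L R" "\<forall>a\<in>L. \<forall>b\<in>R. flips s a b \<longleftrightarrow> a = \<eta> v \<or> b = \<eta> v"
    using switch_exists[of "\<eta> v"] vZ assms(2) by blast
  then have sH: "s \<in> H" using assms(1) vZ by blast
  have "flips (compose (L \<union> R) s \<eta>) a b \<longleftrightarrow> (a \<in> insert v F) \<noteq> (b \<in> insert v F)"
    if ab: "a \<in> L" "b \<in> R" for a b
  proof -
    have "flips s (\<eta> a) (\<eta> b) \<longleftrightarrow> \<eta> a = \<eta> v \<or> \<eta> b = \<eta> v"
      using s(2) side_permsD[OF \<eta>p] ab by blast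
    moreover have "\<eta> a = \<eta> v \<longleftrightarrow> a = v" "\<eta> b = \<eta> v \<longleftrightarrow> b = v"
      using inj_on_eq_iff[OF side_permsD(3)[OF \<eta>p]] ab vV by auto
    ultimately show ?thesis
      using \<eta>(2) ab insert.hyps(2) disjoint by (auto simp: flips_compose)
  qed
  then show ?case using mult[OF sH \<eta>(1)] by blast
qed

text \<open>Relative to a base pair \<open>(a0, b0)\<close>, the entry at \<open>(a, b)\<close> is
  the exclusive or of the entries at \<open>(a, b0)\<close>, \<open>(a0, b)\<close> and
  \<open>(a0, b0)\<close>. On a finite set such a matrix is produced by switching the rows and
  columns that deviate from the base entry, followed by \<open>\<rho>\<close> if that entry is
  true.\<close>

lemma rectangular_mem:
  assumes switches: "\<And>\<sigma> v. \<sigma> \<in> side_perms L R \<Longrightarrow> v \<in> Z \<Longrightarrow>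
      \<forall>a\<in>L. \<forall>b\<in>R. flips \<sigma> a b \<longleftrightarrow> a = v \<or> b = v \<Longrightarrow> \<sigma> \<in> H"
    and Z: "Z \<subseteq> L \<union> R" "\<And>\<eta> v. \<eta> \<in> side_perms L R \<Longrightarrow> v \<in> Z \<Longrightarrow> \<eta> v \<in> Z"
    and \<rho>: "\<rho> \<in> H" "\<forall>a\<in>L. \<forall>b\<in>R. flips \<rho> a b"
    and \<sigma>: "\<sigma> \<in> side_perms L R" "rectangular \<sigma>"
    and left: "L \<subseteq> Z \<or> (\<forall>a\<in>L. \<forall>a'\<in>L. \<forall>b\<in>R. flips \<sigma> a b = flips \<sigma> a' b)"
    and right: "R \<subseteq> Z \<or> (\<forall>a\<in>L. \<forall>b\<in>R. \<forall>b'\<in>R. flips \<sigma> a b = flips \<sigma> a b')"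
  shows "\<sigma> \<in> H"
proof (rule mem_if_flips_agree[OF \<sigma>(1)])
  fix A B assume AB: "finite A" "finite B" "A \<subseteq> L" "B \<subseteq> R"
  have "L \<noteq> {}" "R \<noteq> {}"
    using random_bipartite.infinite_right[OF dual] infinite_right by (simp_all add: infinite_imp_nonempty)
  then obtain a0 b0 where ab0: "a0 \<in> L" "b0 \<in> R" by blast
  define F where "F = {a\<in>A. flips \<sigma> a b0 \<noteq> flips \<sigma> a0 b0} \<union> {b\<in>B. flips \<sigma> a0 b \<noteq> flips \<sigma> a0 b0}"
  \<comment> \<open>If a side is not contained in \<open>Z\<close>, the matrix is constant along it
    and that side contributes nothing to \<open>F\<close>.\<close>
  have FZ: "F \<subseteq> Z" using left right ab0 AB unfolding F_def by blast
  have finF: "finite F" using AB by (simp add: F_def)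
  have "\<exists>\<eta>\<in>H. \<forall>a\<in>L. \<forall>b\<in>R. flips \<eta> a b \<longleftrightarrow> (a \<in> F) \<noteq> (b \<in> F)"
    by (rule finite_switch_mem[of Z]) (fact switches Z finF FZ)+
  then obtain \<eta> where \<eta>: "\<eta> \<in> H" "\<forall>a\<in>L. \<forall>b\<in>R. flips \<eta> a b \<longleftrightarrow> (a \<in> F) \<noteq> (b \<in> F)" by blast
  have \<eta>p: "\<eta> \<in> side_perms L R" using \<eta> sub_perms by blast
  define \<theta> where "\<theta> = (if flips \<sigma> a0 b0 then compose (L \<union> R) \<rho> \<eta> else \<eta>)"
  have "\<theta> \<in> H" unfolding \<theta>_def using mult \<eta>(1) \<rho>(1) by simp
  moreover have "flips \<theta> a b = flips \<sigma> a b" if "a \<in> A" "b \<in> B" for a b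
  proof -
    have ab: "a \<in> L" "b \<in> R" using that AB by auto
    have "flips \<rho> (\<eta> a) (\<eta> b)" using \<rho>(2) side_permsD[OF \<eta>p] ab by blast
    then have "flips \<theta> a b \<longleftrightarrow> flips \<eta> a b \<noteq> flips \<sigma> a0 b0"
      using ab by (simp add: \<theta>_def flips_compose)
    moreover have "a \<in> F \<longleftrightarrow> flips \<sigma> a b0 \<noteq> flips \<sigma> a0 b0" "b \<in> F \<longleftrightarrow> flips \<sigma> a0 b \<noteq> flips \<sigma> a0 b0"
      using ab that AB disjoint by (auto simp: F_def)
    moreover have "(flips \<sigma> a b = flips \<sigma> a0 b) = (flips \<sigma> a b0 = flips \<sigma> a0 b0)"
      using \<sigma>(2) ab ab0 unfolding rectangular_def by blast
    ultimately show ?thesis using \<eta>(2) ab by blast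
  qed
  ultimately show "\<exists>\<eta>\<in>H. \<forall>a\<in>A. \<forall>b\<in>B. flips \<eta> a b = flips \<sigma> a b" by blast
qed

end

section \<open>Closed subgroups of the side-preserving permutations\<close>

text \<open>The locale asks for a symmetric relation, while \<open>P1\<close> only relates left to
  right vertices. On cross-edges \<open>P2\<close> becomes non-adjacency.\<close>

definition adjacent :: "'a bigraph \<Rightarrow> 'a \<Rightarrow> 'a \<Rightarrow> bool" where
  "adjacent \<Gamma> x y \<longleftrightarrow> (x, y) \<in> P1 \<Gamma> \<or> (y, x) \<in> P1 \<Gamma>"

lemma adjacent_cross:
  assumes "bipartite_graph \<Gamma>" "a \<in> Rl \<Gamma>" "b \<in> Rr \<Gamma>"
  shows "(a, b) \<in> P1 \<Gamma> \<longleftrightarrow> adjacent \<Gamma> a b" "(a, b) \<in> P2 \<Gamma> \<longleftrightarrow> \<not> adjacent \<Gamma> a b"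
proof -
  have "(a, b) \<in> P1 \<Gamma> \<union> P2 \<Gamma>" "(b, a) \<notin> P1 \<Gamma> \<union> P2 \<Gamma>" "P1 \<Gamma> \<inter> P2 \<Gamma> = {}"
    using assms by (auto simp: bipartite_graph_def)
  then show "(a, b) \<in> P1 \<Gamma> \<longleftrightarrow> adjacent \<Gamma> a b" "(a, b) \<in> P2 \<Gamma> \<longleftrightarrow> \<not> adjacent \<Gamma> a b"
    by (auto simp: adjacent_def)
qed

lemma random_bipartite_adjacent:
  assumes "random_bipartite_graph \<Gamma>"
  shows "random_bipartite (Rl \<Gamma>) (Rr \<Gamma>) (adjacent \<Gamma>)"
proof
  have bip: "bipartite_graph \<Gamma>" and ext: "\<And>n. extension_property \<Gamma> n"
    using assms by (auto simp: random_bipartite_graph_def)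
  show "Rl \<Gamma> \<inter> Rr \<Gamma> = {}" "countable (Rl \<Gamma>)" "countable (Rr \<Gamma>)"
    using assms by (auto simp: random_bipartite_graph_def bipartite_graph_def verts_def)
  show sym: "adjacent \<Gamma> x y = adjacent \<Gamma> y x" for x y by (auto simp: adjacent_def)
  fix X Y :: "'a set"
  assume fin: "finite X" "finite Y" and dj: "X \<inter> Y = {}"
  show "\<exists>v\<in>Rr \<Gamma>. (\<forall>x\<in>X. adjacent \<Gamma> x v) \<and> (\<forall>y\<in>Y. \<not> adjacent \<Gamma> y v)"
    if sub: "X \<subseteq> Rl \<Gamma>" "Y \<subseteq> Rl \<Gamma>"
  proof -
    from ext[of "max (card X) (card Y)", unfolded extension_property_def, rule_format, of X Y "{}" "{}"]
      fin dj sub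
    have "\<exists>v\<in>Rr \<Gamma>. (\<forall>x\<in>X. (x, v) \<in> P1 \<Gamma>) \<and> (\<forall>x\<in>Y. (x, v) \<in> P2 \<Gamma>)"
      by auto
    then obtain v where "v \<in> Rr \<Gamma>" "\<forall>x\<in>X. (x, v) \<in> P1 \<Gamma>" "\<forall>x\<in>Y. (x, v) \<in> P2 \<Gamma>" by blast
    then show ?thesis using sub adjacent_cross[OF bip] by blast
  qed
  show "\<exists>v\<in>Rl \<Gamma>. (\<forall>x\<in>X. adjacent \<Gamma> v x) \<and> (\<forall>y\<in>Y. \<not> adjacent \<Gamma> v y)"
    if sub: "X \<subseteq> Rr \<Gamma>" "Y \<subseteq> Rr \<Gamma>"
  proof -
    from ext[of "max (card X) (card Y)", unfolded extension_property_def, rule_format, of "{}" "{}" X Y]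
      fin dj sub
    have "\<exists>w\<in>Rl \<Gamma>. (\<forall>x\<in>X. (w, x) \<in> P1 \<Gamma>) \<and> (\<forall>x\<in>Y. (w, x) \<in> P2 \<Gamma>)"
      by auto
    then obtain w where "w \<in> Rl \<Gamma>" "\<forall>x\<in>X. (w, x) \<in> P1 \<Gamma>" "\<forall>x\<in>Y. (w, x) \<in> P2 \<Gamma>" by blast
    then show ?thesis using sub adjacent_cross[OF bip] by blast
  qed
qed

lemma carrier_Sym_lr: "carrier (Sym_lr \<Gamma>) = side_perms (Rl \<Gamma>) (Rr \<Gamma>)"
  by (simp add: Sym_lr_def side_perms_def verts_def)

lemma carrier_Sym_lr_Bij: "\<sigma> \<in> carrier (Sym_lr \<Gamma>) \<Longrightarrow> \<sigma> \<in> Bij (verts \<Gamma>)"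
  by (simp add: Sym_lr_def)

lemma mult_Sym_lr:
  assumes "\<sigma> \<in> carrier (Sym_lr \<Gamma>)" "\<tau> \<in> carrier (Sym_lr \<Gamma>)"
  shows "\<sigma> \<otimes>\<^bsub>Sym_lr \<Gamma>\<^esub> \<tau> = compose (verts \<Gamma>) \<sigma> \<tau>"
  using assms[THEN carrier_Sym_lr_Bij] by (simp add: Sym_lr_def BijGroup_def)

lemma inv_Sym_lr:
  assumes "\<sigma> \<in> carrier (Sym_lr \<Gamma>)"
  shows "inv\<^bsub>Sym_lr \<Gamma>\<^esub> \<sigma> = restrict (inv_into (verts \<Gamma>) \<sigma>) (verts \<Gamma>)"
proof -
  have "Sym_lr \<Gamma> = (BijGroup (verts \<Gamma>))\<lparr>carrier := carrier (Sym_lr \<Gamma>)\<rparr>"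
    by (simp add: Sym_lr_def)
  then have "inv\<^bsub>Sym_lr \<Gamma>\<^esub> \<sigma> = inv\<^bsub>BijGroup (verts \<Gamma>)\<^esub> \<sigma>"
    using group.m_inv_consistent[OF group_BijGroup subgroup_Sym_lr assms] by simp
  then show ?thesis by (simp add: inv_BijGroup[OF carrier_Sym_lr_Bij[OF assms]])
qed

text \<open>A basic open set in a product of discrete spaces restricts finitely many coordinates, so
  a permutation lies in the closure of \<open>H\<close> iff members of \<open>H\<close> match it on
  every finite set.\<close>

lemma closedin_Sym_lr_iff:
  "closedin (Sym_lr_topology \<Gamma>) H \<longleftrightarrow> H \<subseteq> carrier (Sym_lr \<Gamma>) \<and>
     (\<forall>\<sigma>\<in>carrier (Sym_lr \<Gamma>).
        (\<forall>S. finite S \<longrightarrow> S \<subseteq> verts \<Gamma> \<longrightarrow> (\<exists>\<eta>\<in>H. \<forall>x\<in>S. \<eta> x = \<sigma> x)) \<longrightarrow> \<sigma> \<in> H)"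
  (is "_ \<longleftrightarrow> H \<subseteq> ?C \<and> ?approx")
proof -
  let ?V = "verts \<Gamma>"
  let ?X = "product_topology (\<lambda>_. discrete_topology ?V) ?V"
  have C_PiE: "?C \<subseteq> ?V \<rightarrow>\<^sub>E ?V"
    using carrier_Sym_lr_Bij by (auto simp: Bij_def bij_betw_def PiE_def)
  have "openin (subtopology ?X ?C) (?C - H) \<longleftrightarrow> ?approx" if H: "H \<subseteq> ?C"
  proof
    assume "openin (subtopology ?X ?C) (?C - H)"
    then obtain T where T: "openin ?X T" "?C - H = T \<inter> ?C" by (auto simp: openin_subtopology)
    show ?approx
    proof (intro ballI impI, rule ccontr)
      fix \<sigma> assume \<sigma>: "\<sigma> \<in> ?C" "\<sigma> \<notin> H"
        and approx: "\<forall>S. finite S \<longrightarrow> S \<subseteq> ?V \<longrightarrow> (\<exists>\<eta>\<in>H. \<forall>x\<in>S. \<eta> x = \<sigma> x)"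
      have "\<sigma> \<in> T" using \<sigma> T(2) by blast
      then obtain U where U: "finite {i \<in> ?V. U i \<noteq> ?V}" "\<sigma> \<in> Pi\<^sub>E ?V U" "Pi\<^sub>E ?V U \<subseteq> T"
        using T(1) unfolding openin_product_topology_alt by fastforce
      \<comment> \<open>Agreement on the coordinates restricted by \<open>U\<close> places
        \<open>\<eta>\<close> in the same basic neighbourhood as \<open>\<sigma>\<close>.\<close>
      obtain \<eta> where \<eta>: "\<eta> \<in> H" "\<forall>x\<in>{i \<in> ?V. U i \<noteq> ?V}. \<eta> x = \<sigma> x"
        using approx U(1) by (metis (no_types, lifting) mem_Collect_eq subsetI)
      have "\<eta> \<in> ?V \<rightarrow>\<^sub>E ?V" using \<eta>(1) H C_PiE by blast
      have "\<eta> \<in> Pi\<^sub>E ?V U"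
      proof (rule PiE_I)
        show "\<eta> x \<in> U x" if "x \<in> ?V" for x
        proof (cases "U x = ?V")
          case True
          then show ?thesis using PiE_mem[OF \<open>\<eta> \<in> ?V \<rightarrow>\<^sub>E ?V\<close> that] by simp
        next
          case False
          then have "\<eta> x = \<sigma> x" using \<eta>(2) that by blast
          then show ?thesis using PiE_mem[OF U(2) that] by simp
        qed
        show "\<eta> x = undefined" if "x \<notin> ?V" for x
          by (rule PiE_arb[OF \<open>\<eta> \<in> ?V \<rightarrow>\<^sub>E ?V\<close> that])
      qed
      then show False using \<eta>(1) U(3) T(2) H by blast
    qed
  next
    assume approx: ?approx
    show "openin (subtopology ?X ?C) (?C - H)"
    proof (subst openin_subopen, intro ballI)
      fix \<sigma> assume \<sigma>: "\<sigma> \<in> ?C - H"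
      with approx have "\<not> (\<forall>S. finite S \<longrightarrow> S \<subseteq> ?V \<longrightarrow> (\<exists>\<eta>\<in>H. \<forall>x\<in>S. \<eta> x = \<sigma> x))"
        by (metis DiffD1 DiffD2)
      then obtain S where S: "finite S" "S \<subseteq> ?V" "\<not> (\<exists>\<eta>\<in>H. \<forall>x\<in>S. \<eta> x = \<sigma> x)"
        by auto
      \<comment> \<open>Prescribing the values of \<open>\<sigma>\<close> on \<open>S\<close> gives
        a basic neighbourhood of \<open>\<sigma>\<close> that misses \<open>H\<close>.\<close>
      define U where "U i = (if i \<in> S then {\<sigma> i} else ?V)" for i
      have \<sigma>V: "\<sigma> \<in> ?V \<rightarrow>\<^sub>E ?V" using \<sigma> C_PiE by blast
      have "{i \<in> ?V. U i \<noteq> ?V} \<subseteq> S" by (auto simp: U_def)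
      then have "finite {i \<in> ?V. U i \<noteq> ?V}" using S(1) by (rule finite_subset)
      moreover have "U i \<subseteq> ?V" if "i \<in> ?V" for i using that \<sigma>V by (auto simp: U_def PiE_iff)
      ultimately have "openin ?X (Pi\<^sub>E ?V U)" by (simp add: openin_PiE_gen)
      moreover have "\<sigma> \<in> Pi\<^sub>E ?V U" using \<sigma>V by (auto simp: U_def PiE_iff)
      moreover have "Pi\<^sub>E ?V U \<inter> H = {}"
      proof -
        have "\<forall>x\<in>S. \<eta> x = \<sigma> x" if "\<eta> \<in> Pi\<^sub>E ?V U" for \<eta>
        proof
          fix x assume "x \<in> S"
          then have "\<eta> x \<in> U x" using that S(2) by (auto dest: PiE_mem)
          then show "\<eta> x = \<sigma> x" using \<open>x \<in> S\<close> by (simp add: U_def)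
        qed
        then show ?thesis using S(3) by blast
      qed
      ultimately show "\<exists>T. openin (subtopology ?X ?C) T \<and> \<sigma> \<in> T \<and> T \<subseteq> ?C - H"
        using \<sigma> by (intro exI[of _ "Pi\<^sub>E ?V U \<inter> ?C"]) (auto intro: openin_subtopology_Int)
    qed
  qed
  then show ?thesis
    unfolding closedin_def topspace_Sym_lr_topology by (auto simp: Sym_lr_topology_def)
qed

lemma closed_generated_minimal:
  assumes "S \<subseteq> H" "closed_subgroup \<Gamma> H"
  shows "closed_generated \<Gamma> S \<subseteq> H"
  unfolding closed_generated_def using assms by (intro hull_minimal)

lemma closed_subgroup_carrier: "closed_subgroup \<Gamma> H \<Longrightarrow> H \<subseteq> carrier (Sym_lr \<Gamma>)"
  by (simp add: closed_subgroup_def subgroup.subset)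

lemma Aut_eq:
  assumes "random_bipartite_graph \<Gamma>"
  shows "Aut \<Gamma> = random_bipartite.automorphisms (Rl \<Gamma>) (Rr \<Gamma>) (adjacent \<Gamma>)"
proof -
  interpret random_bipartite "Rl \<Gamma>" "Rr \<Gamma>" "adjacent \<Gamma>"
    by (rule random_bipartite_adjacent[OF assms])
  have bip: "bipartite_graph \<Gamma>" using assms by (simp add: random_bipartite_graph_def)
  have cross: "P1 \<Gamma> \<subseteq> Rl \<Gamma> \<times> Rr \<Gamma>" "P2 \<Gamma> \<subseteq> Rl \<Gamma> \<times> Rr \<Gamma>"
    using bip by (auto simp: bipartite_graph_def)
  show ?thesis
  proof (intro subset_antisym subsetI)
    fix \<sigma> assume \<sigma>: "\<sigma> \<in> Aut \<Gamma>"
    then have bij: "\<sigma> \<in> Bij (verts \<Gamma>)"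
      and sides: "\<And>a. a \<in> verts \<Gamma> \<Longrightarrow> (a \<in> Rl \<Gamma> \<longleftrightarrow> \<sigma> a \<in> Rl \<Gamma>) \<and> (a \<in> Rr \<Gamma> \<longleftrightarrow> \<sigma> a \<in> Rr \<Gamma>)"
      and P1: "\<And>a b. a \<in> verts \<Gamma> \<Longrightarrow> b \<in> verts \<Gamma> \<Longrightarrow> (a, b) \<in> P1 \<Gamma> \<longleftrightarrow> (\<sigma> a, \<sigma> b) \<in> P1 \<Gamma>"
      unfolding Aut_def by blast+
    have im: "\<sigma> ` verts \<Gamma> = verts \<Gamma>" using bij by (simp add: Bij_def bij_betw_def)
    have "\<sigma> ` A = A" if A: "A = Rl \<Gamma> \<or> A = Rr \<Gamma>" for A
    proof
      show "\<sigma> ` A \<subseteq> A" using A sides by (auto simp: verts_def)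
      show "A \<subseteq> \<sigma> ` A"
      proof
        fix y assume y: "y \<in> A"
        with A have "y \<in> \<sigma> ` verts \<Gamma>" unfolding im by (auto simp: verts_def)
        then obtain x where "x \<in> verts \<Gamma>" "y = \<sigma> x" by blast
        then show "y \<in> \<sigma> ` A" using y A sides by blast
      qed
    qed
    then have perm: "\<sigma> \<in> side_perms (Rl \<Gamma>) (Rr \<Gamma>)"
      using bij by (simp add: side_perms_def verts_def)
    have "\<not> flips \<sigma> a b" if "a \<in> Rl \<Gamma>" "b \<in> Rr \<Gamma>" for a b
      using that P1[of a b] adjacent_cross(1)[OF bip] side_permsD(1,2)[OF perm]
      by (auto simp: flips_def verts_def)
    then show "\<sigma> \<in> automorphisms" using perm by (simp add: automorphisms_def)
  next
    fix \<sigma> assume \<sigma>: "\<sigma> \<in> automorphisms"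
    then have perm: "\<sigma> \<in> side_perms (Rl \<Gamma>) (Rr \<Gamma>)"
      and nf: "\<And>a b. a \<in> Rl \<Gamma> \<Longrightarrow> b \<in> Rr \<Gamma> \<Longrightarrow> adjacent \<Gamma> a b = adjacent \<Gamma> (\<sigma> a) (\<sigma> b)"
      by (auto simp: automorphisms_def flips_def)
    note side = side_permsD(1,2)[OF perm]
    have sides: "a \<in> Rl \<Gamma> \<longleftrightarrow> \<sigma> a \<in> Rl \<Gamma>" "a \<in> Rr \<Gamma> \<longleftrightarrow> \<sigma> a \<in> Rr \<Gamma>" if "a \<in> verts \<Gamma>" for a
      using that side[of a] disjoint by (auto simp: verts_def)
    have "((a, b) \<in> P1 \<Gamma> \<longleftrightarrow> (\<sigma> a, \<sigma> b) \<in> P1 \<Gamma>) \<and> ((a, b) \<in> P2 \<Gamma> \<longleftrightarrow> (\<sigma> a, \<sigma> b) \<in> P2 \<Gamma>)"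
      if ab: "a \<in> verts \<Gamma>" "b \<in> verts \<Gamma>" for a b
    proof (cases "a \<in> Rl \<Gamma> \<and> b \<in> Rr \<Gamma>")
      case True
      then have "\<sigma> a \<in> Rl \<Gamma>" "\<sigma> b \<in> Rr \<Gamma>" using side by blast+
      then show ?thesis
        using True adjacent_cross[OF bip, of a b] adjacent_cross[OF bip, of "\<sigma> a" "\<sigma> b"] nf[of a b]
        by simp
    next
      \<comment> \<open>Both types relate only left to right vertices, and \<open>\<sigma>\<close>
        preserves sides, so neither type holds before or after.\<close>
      case False
      then show ?thesis using cross sides[OF ab(1)] sides[OF ab(2)] by blast
    qed
    moreover have "\<sigma> \<in> Bij (verts \<Gamma>)" using side_permsD(4)[OF perm] by (simp add: verts_def)
    ultimately show "\<sigma> \<in> Aut \<Gamma>" unfolding Aut_def using sides by blast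
  qed
qed

lemma closed_group_adjacent:
  assumes "random_bipartite_graph \<Gamma>" "closed_subgroup \<Gamma> H" "Aut \<Gamma> \<subseteq> H"
  shows "closed_group (Rl \<Gamma>) (Rr \<Gamma>) (adjacent \<Gamma>) H"
proof -
  interpret random_bipartite "Rl \<Gamma>" "Rr \<Gamma>" "adjacent \<Gamma>"
    by (rule random_bipartite_adjacent[OF assms(1)])
  have sub: "subgroup H (Sym_lr \<Gamma>)" and cl: "closedin (Sym_lr_topology \<Gamma>) H"
    using assms(2) by (auto simp: closed_subgroup_def)
  note HC = subgroup.mem_carrier[OF sub]
  show ?thesis
  proof
    show "H \<subseteq> side_perms (Rl \<Gamma>) (Rr \<Gamma>)" using HC by (auto simp: carrier_Sym_lr)
    show "compose (Rl \<Gamma> \<union> Rr \<Gamma>) \<sigma> \<tau> \<in> H" if "\<sigma> \<in> H" "\<tau> \<in> H" for \<sigma> \<tau>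
      using subgroup.m_closed[OF sub that] mult_Sym_lr[OF HC[OF that(1)] HC[OF that(2)]]
      by (simp add: verts_def)
    show "restrict (inv_into (Rl \<Gamma> \<union> Rr \<Gamma>) \<sigma>) (Rl \<Gamma> \<union> Rr \<Gamma>) \<in> H" if "\<sigma> \<in> H" for \<sigma>
      using subgroup.m_inv_closed[OF sub that] inv_Sym_lr[OF HC[OF that]] by (simp add: verts_def)
    show "\<sigma> \<in> H" if "\<sigma> \<in> side_perms (Rl \<Gamma>) (Rr \<Gamma>)"
      "\<And>S. finite S \<Longrightarrow> S \<subseteq> Rl \<Gamma> \<union> Rr \<Gamma> \<Longrightarrow> \<exists>\<eta>\<in>H. \<forall>x\<in>S. \<eta> x = \<sigma> x" for \<sigma>
      using cl that unfolding closedin_Sym_lr_iff carrier_Sym_lr verts_def by blast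
    show "automorphisms \<subseteq> H" using assms(3) Aut_eq[OF assms(1)] by simp
  qed
qed

lemma is_switch_iff_flips:
  assumes "random_bipartite_graph \<Gamma>" "\<sigma> \<in> carrier (Sym_lr \<Gamma>)"
  shows "is_switch \<Gamma> A \<sigma> \<longleftrightarrow>
    (\<forall>a\<in>Rl \<Gamma>. \<forall>b\<in>Rr \<Gamma>. random_bipartite.flips (adjacent \<Gamma>) \<sigma> a b \<longleftrightarrow> card ({a, b} \<inter> A) = 1)"
proof -
  interpret random_bipartite "Rl \<Gamma>" "Rr \<Gamma>" "adjacent \<Gamma>"
    by (rule random_bipartite_adjacent[OF assms(1)])
  have bip: "bipartite_graph \<Gamma>" using assms by (simp add: random_bipartite_graph_def)
  note side = side_permsD(1,2)[OF assms(2)[unfolded carrier_Sym_lr]]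
  have "(\<forall>P\<in>{P1 \<Gamma>, P2 \<Gamma>}. ((a, b) \<in> P \<longleftrightarrow> (\<sigma> a, \<sigma> b) \<in> P) \<longleftrightarrow> card ({a, b} \<inter> A) \<noteq> 1) \<longleftrightarrow>
      (flips \<sigma> a b \<longleftrightarrow> card ({a, b} \<inter> A) = 1)" if "a \<in> Rl \<Gamma>" "b \<in> Rr \<Gamma>" for a b
    using adjacent_cross[OF bip that] adjacent_cross[OF bip side(1)[OF that(1)] side(2)[OF that(2)]]
    by (auto simp: flips_def)
  then show ?thesis
    unfolding is_switch_def using carrier_Sym_lr_Bij[OF assms(2)] by simp
qed

lemma is_switch_vertex_iff_flips:
  assumes "random_bipartite_graph \<Gamma>" "\<sigma> \<in> carrier (Sym_lr \<Gamma>)"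
  shows "is_switch \<Gamma> {v} \<sigma> \<longleftrightarrow>
    (\<forall>a\<in>Rl \<Gamma>. \<forall>b\<in>Rr \<Gamma>. random_bipartite.flips (adjacent \<Gamma>) \<sigma> a b \<longleftrightarrow> a = v \<or> b = v)"
proof -
  have "Rl \<Gamma> \<inter> Rr \<Gamma> = {}"
    using assms(1) by (simp add: random_bipartite_graph_def bipartite_graph_def)
  then have "card ({a, b} \<inter> {v}) = 1 \<longleftrightarrow> a = v \<or> b = v" if "a \<in> Rl \<Gamma>" "b \<in> Rr \<Gamma>" for a b
    using that by (cases "a = v"; cases "b = v") auto
  then show ?thesis unfolding is_switch_iff_flips[OF assms] by simp
qed

section \<open>Rectangularity of the full switch group\<close>

text \<open>Parities of 2 by 2 submatrices add under composition, which gives the subgroup property.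
  Each instance involves the values of \<open>\<sigma>\<close> at four vertices only, which gives
  closedness.\<close>

lemma closed_subgroup_rectangular:
  assumes "random_bipartite_graph \<Gamma>"
  shows "closed_subgroup \<Gamma> {\<sigma> \<in> carrier (Sym_lr \<Gamma>).
    random_bipartite.rectangular (Rl \<Gamma>) (Rr \<Gamma>) (adjacent \<Gamma>) \<sigma>}"
proof -
  interpret random_bipartite "Rl \<Gamma>" "Rr \<Gamma>" "adjacent \<Gamma>"
    by (rule random_bipartite_adjacent[OF assms])
  interpret G: group "Sym_lr \<Gamma>" by (rule group_Sym_lr)
  let ?L = "Rl \<Gamma>" and ?R = "Rr \<Gamma>" and ?V = "verts \<Gamma>" and ?C = "carrier (Sym_lr \<Gamma>)"
  have side: "\<sigma> a \<in> ?L" if "\<sigma> \<in> ?C" "a \<in> ?L" for \<sigma> a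
    using that(2) side_permsD(1)[of \<sigma> ?L ?R] that(1) by (simp add: carrier_Sym_lr)
  have side': "\<sigma> a \<in> ?R" if "\<sigma> \<in> ?C" "a \<in> ?R" for \<sigma> a
    using that(2) side_permsD(2)[of \<sigma> ?L ?R] that(1) by (simp add: carrier_Sym_lr)
  have "subgroup {\<sigma> \<in> ?C. rectangular \<sigma>} (Sym_lr \<Gamma>)"
  proof (rule G.subgroupI)
    have "\<one>\<^bsub>Sym_lr \<Gamma>\<^esub> = (\<lambda>x\<in>?V. x)" by (simp add: Sym_lr_def BijGroup_def)
    then have "rectangular \<one>\<^bsub>Sym_lr \<Gamma>\<^esub>" by (simp add: rectangular_def flips_def verts_def)
    then show "{\<sigma> \<in> ?C. rectangular \<sigma>} \<noteq> {}" using G.one_closed by blast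
  next
    fix \<sigma> assume "\<sigma> \<in> {\<sigma> \<in> ?C. rectangular \<sigma>}"
    then have \<sigma>: "\<sigma> \<in> ?C" "rectangular \<sigma>" by auto
    let ?i = "inv\<^bsub>Sym_lr \<Gamma>\<^esub> \<sigma>"
    have i: "?i \<in> ?C" using \<sigma>(1) by (rule G.inv_closed)
    have "\<sigma> (?i x) = x" if "x \<in> ?V" for x
    proof -
      have "\<sigma> ` ?V = ?V" using carrier_Sym_lr_Bij[OF \<sigma>(1)] by (simp add: Bij_def bij_betw_def)
      then show ?thesis using that by (simp add: inv_Sym_lr[OF \<sigma>(1)] f_inv_into_f)
    qed
    then have fl: "flips ?i a b = flips \<sigma> (?i a) (?i b)" if "a \<in> ?L" "b \<in> ?R" for a b
      using that by (auto simp: flips_def verts_def)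
    have "rectangular ?i"
      unfolding rectangular_def
    proof (intro ballI)
      fix a a' b b' assume mem: "a \<in> ?L" "a' \<in> ?L" "b \<in> ?R" "b' \<in> ?R"
      show "(flips ?i a b = flips ?i a' b) = (flips ?i a b' = flips ?i a' b')"
        unfolding fl[OF mem(1,3)] fl[OF mem(2,3)] fl[OF mem(1,4)] fl[OF mem(2,4)]
        by (rule \<sigma>(2)[unfolded rectangular_def, rule_format])
          (simp_all add: mem side[OF i] side'[OF i])
    qed
    then show "?i \<in> {\<sigma> \<in> ?C. rectangular \<sigma>}" using i by blast
  next
    fix \<sigma> \<tau> assume "\<sigma> \<in> {\<sigma> \<in> ?C. rectangular \<sigma>}" "\<tau> \<in> {\<sigma> \<in> ?C. rectangular \<sigma>}"
    then have \<sigma>: "\<sigma> \<in> ?C" "rectangular \<sigma>" and \<tau>: "\<tau> \<in> ?C" "rectangular \<tau>" by auto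
    have fl: "flips (\<sigma> \<otimes>\<^bsub>Sym_lr \<Gamma>\<^esub> \<tau>) a b \<longleftrightarrow> flips \<tau> a b \<noteq> flips \<sigma> (\<tau> a) (\<tau> b)"
      if "a \<in> ?L" "b \<in> ?R" for a b
      using flips_compose[of a b] that by (simp add: mult_Sym_lr[OF \<sigma>(1) \<tau>(1)] verts_def)
    have xor: "(p1 = p2) = (p3 = p4) \<Longrightarrow> (q1 = q2) = (q3 = q4) \<Longrightarrow>
        ((p1 \<noteq> q1) = (p2 \<noteq> q2)) = ((p3 \<noteq> q3) = (p4 \<noteq> q4))" for p1 p2 p3 p4 q1 q2 q3 q4 :: bool
      by (cases p1; cases p2; cases p3; cases p4) auto
    have "rectangular (\<sigma> \<otimes>\<^bsub>Sym_lr \<Gamma>\<^esub> \<tau>)"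
      unfolding rectangular_def
    proof (intro ballI)
      fix a a' b b' assume mem: "a \<in> ?L" "a' \<in> ?L" "b \<in> ?R" "b' \<in> ?R"
      show "(flips (\<sigma> \<otimes>\<^bsub>Sym_lr \<Gamma>\<^esub> \<tau>) a b = flips (\<sigma> \<otimes>\<^bsub>Sym_lr \<Gamma>\<^esub> \<tau>) a' b) =
          (flips (\<sigma> \<otimes>\<^bsub>Sym_lr \<Gamma>\<^esub> \<tau>) a b' = flips (\<sigma> \<otimes>\<^bsub>Sym_lr \<Gamma>\<^esub> \<tau>) a' b')"
        unfolding fl[OF mem(1,3)] fl[OF mem(2,3)] fl[OF mem(1,4)] fl[OF mem(2,4)]
        by (rule xor; rule \<sigma>(2)[unfolded rectangular_def, rule_format]
              \<tau>(2)[unfolded rectangular_def, rule_format])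
          (simp_all add: mem side[OF \<tau>(1)] side'[OF \<tau>(1)])
    qed
    then show "\<sigma> \<otimes>\<^bsub>Sym_lr \<Gamma>\<^esub> \<tau> \<in> {\<sigma> \<in> ?C. rectangular \<sigma>}"
      using G.m_closed[OF \<sigma>(1) \<tau>(1)] by blast
  qed auto
  moreover have "closedin (Sym_lr_topology \<Gamma>) {\<sigma> \<in> ?C. rectangular \<sigma>}"
    unfolding closedin_Sym_lr_iff
  proof (intro conjI ballI impI CollectI)
    fix \<sigma> assume "\<sigma> \<in> ?C"
      and approx: "\<forall>S. finite S \<longrightarrow> S \<subseteq> ?V \<longrightarrow> (\<exists>\<eta>\<in>{\<sigma> \<in> ?C. rectangular \<sigma>}. \<forall>x\<in>S. \<eta> x = \<sigma> x)"
    show "rectangular \<sigma>"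
      unfolding rectangular_def
    proof (intro ballI)
      fix a a' b b' assume mem: "a \<in> ?L" "a' \<in> ?L" "b \<in> ?R" "b' \<in> ?R"
      have "\<exists>\<eta>\<in>{\<sigma> \<in> ?C. rectangular \<sigma>}. \<forall>x\<in>{a, a', b, b'}. \<eta> x = \<sigma> x"
        using mem by (intro approx[rule_format]) (auto simp: verts_def)
      then obtain \<eta> where \<eta>: "rectangular \<eta>" "\<eta> a = \<sigma> a" "\<eta> a' = \<sigma> a'" "\<eta> b = \<sigma> b" "\<eta> b' = \<sigma> b'"
        by auto
      have "(flips \<eta> a b = flips \<eta> a' b) = (flips \<eta> a b' = flips \<eta> a' b')"
        by (rule \<eta>(1)[unfolded rectangular_def, rule_format]) (fact mem)+
      then show "(flips \<sigma> a b = flips \<sigma> a' b) = (flips \<sigma> a b' = flips \<sigma> a' b')"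
        by (simp only: flips_def \<eta>(2-))
    qed
  qed auto
  ultimately show ?thesis by (simp add: closed_subgroup_def)
qed

text \<open>It suffices to check generators: the matrix of an automorphism is constantly false, and
  that of a vertex switch is true exactly on one row or one column.\<close>

lemma switch_group_subset_rectangular:
  assumes "random_bipartite_graph \<Gamma>"
  shows "switch_group \<Gamma> X \<subseteq> {\<sigma> \<in> carrier (Sym_lr \<Gamma>).
    random_bipartite.rectangular (Rl \<Gamma>) (Rr \<Gamma>) (adjacent \<Gamma>) \<sigma>}"
  unfolding switch_group_def
proof (intro closed_generated_minimal Un_least subsetI)
  interpret random_bipartite "Rl \<Gamma>" "Rr \<Gamma>" "adjacent \<Gamma>"
    by (rule random_bipartite_adjacent[OF assms])
  fix \<sigma> assume "\<sigma> \<in> Aut \<Gamma>"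
  then show "\<sigma> \<in> {\<sigma> \<in> carrier (Sym_lr \<Gamma>). rectangular \<sigma>}"
    unfolding Aut_eq[OF assms] automorphisms_def carrier_Sym_lr by (simp add: rectangular_def)
next
  interpret random_bipartite "Rl \<Gamma>" "Rr \<Gamma>" "adjacent \<Gamma>"
    by (rule random_bipartite_adjacent[OF assms])
  fix \<sigma> assume "\<sigma> \<in> {\<sigma> \<in> carrier (Sym_lr \<Gamma>). \<exists>i\<in>X. \<exists>v\<in>part \<Gamma> i. is_switch \<Gamma> {v} \<sigma>}"
  then obtain v where \<sigma>: "\<sigma> \<in> carrier (Sym_lr \<Gamma>)" "is_switch \<Gamma> {v} \<sigma>" by blast
  have "flips \<sigma> a b \<longleftrightarrow> a = v \<or> b = v" if "a \<in> Rl \<Gamma>" "b \<in> Rr \<Gamma>" for a b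
    using \<sigma>(2) that unfolding is_switch_vertex_iff_flips[OF assms \<sigma>(1)] by blast
  then have "rectangular \<sigma>" using disjoint unfolding rectangular_def by auto
  then show "\<sigma> \<in> {\<sigma> \<in> carrier (Sym_lr \<Gamma>). rectangular \<sigma>}" using \<sigma>(1) by blast
qed (rule closed_subgroup_rectangular[OF assms])

section \<open>Determining \<open>G\<close> from the sides whose switches it contains\<close>

theorem theorem5p1:
  fixes \<Gamma> :: "'a bigraph" and \<rho> :: "'a \<Rightarrow> 'a" and G :: "('a \<Rightarrow> 'a) set"
  assumes "random_bipartite_graph \<Gamma>"
    and "\<rho> \<in> carrier (Sym_lr \<Gamma>)" and "is_switch \<Gamma> (Rl \<Gamma>) \<rho>"
    and "closed_subgroup \<Gamma> G"
    and "star \<Gamma> \<rho> (Aut \<Gamma>) \<subseteq> G" and "G \<subseteq> switch_group \<Gamma> {Lft, Rgt}"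
  shows "(\<exists>X. is_largest (\<lambda>Y. star \<Gamma> \<rho> (switch_group \<Gamma> Y) \<subseteq> G) X) \<and>
         (\<forall>X. is_largest (\<lambda>Y. star \<Gamma> \<rho> (switch_group \<Gamma> Y) \<subseteq> G) X \<longrightarrow>
              G \<subseteq> star \<Gamma> \<rho> (switch_group \<Gamma> X) \<and> G = star \<Gamma> \<rho> (switch_group \<Gamma> X))"
proof -
  interpret random_bipartite "Rl \<Gamma>" "Rr \<Gamma>" "adjacent \<Gamma>"
    by (rule random_bipartite_adjacent[OF assms(1)])
  let ?C = "carrier (Sym_lr \<Gamma>)"
  define sw where "sw Y = {\<sigma> \<in> ?C. \<exists>i\<in>Y. \<exists>v\<in>part \<Gamma> i. is_switch \<Gamma> {v} \<sigma>}" for Y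
  \<comment> \<open>Since \<open>sw Y\<close> is the union of the sets \<open>sw {i}\<close> for
    \<open>i\<close> in \<open>Y\<close>, the admissible \<open>Y\<close> will be exactly the
    subsets of \<open>X0\<close>; hence \<open>X0\<close> is the only largest one.\<close>
  define X0 where "X0 = {i. sw {i} \<subseteq> G}"
  have Aut_C: "Aut \<Gamma> \<subseteq> ?C"
    unfolding Aut_eq[OF assms(1)] automorphisms_def carrier_Sym_lr by blast
  have insert_G: "insert \<rho> (Aut \<Gamma>) \<subseteq> G"
    using assms(5) hull_subset[of "insert \<rho> (Aut \<Gamma>)" "closed_subgroup \<Gamma>"]
    unfolding star_def closed_generated_def by blast
  have S: "switch_group \<Gamma> Y = closed_generated \<Gamma> (Aut \<Gamma> \<union> sw Y)" for Y
    by (simp add: switch_group_def sw_def)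
  have S_gen: "Aut \<Gamma> \<union> sw Y \<subseteq> switch_group \<Gamma> Y" for Y
    unfolding S closed_generated_def by (rule hull_subset)
  have S_C: "switch_group \<Gamma> Y \<subseteq> ?C" for Y
    unfolding S using Aut_C
    by (intro closed_subgroup_carrier[OF closed_subgroup_closed_generated]) (auto simp: sw_def)
  have star_gen: "insert \<rho> (switch_group \<Gamma> Y) \<subseteq> star \<Gamma> \<rho> (switch_group \<Gamma> Y)" for Y
    unfolding star_def closed_generated_def by (rule hull_subset)
  have star_iff: "star \<Gamma> \<rho> (switch_group \<Gamma> Y) \<subseteq> G \<longleftrightarrow> Y \<subseteq> X0" for Y
  proof
    assume "star \<Gamma> \<rho> (switch_group \<Gamma> Y) \<subseteq> G"
    then have "sw Y \<subseteq> G" using S_gen[of Y] star_gen[of Y] by blast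
    then show "Y \<subseteq> X0" unfolding X0_def sw_def by blast
  next
    assume "Y \<subseteq> X0"
    then have "sw Y \<subseteq> G" unfolding X0_def sw_def by blast
    then have "switch_group \<Gamma> Y \<subseteq> G"
      unfolding S using insert_G assms(4) by (intro closed_generated_minimal) auto
    then show "star \<Gamma> \<rho> (switch_group \<Gamma> Y) \<subseteq> G"
      unfolding star_def using insert_G assms(4) by (intro closed_generated_minimal) auto
  qed
  then have largest: "is_largest (\<lambda>Y. star \<Gamma> \<rho> (switch_group \<Gamma> Y) \<subseteq> G) X \<longleftrightarrow> X = X0" for X
    unfolding is_largest_def by blast

  interpret G: closed_group "Rl \<Gamma>" "Rr \<Gamma>" "adjacent \<Gamma>" G
    using closed_group_adjacent[OF assms(1,4)] insert_G by blast
  interpret G': closed_group "Rr \<Gamma>" "Rl \<Gamma>" "adjacent \<Gamma>" G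
    by (rule G.dual_closed_group)
  let ?H = "star \<Gamma> \<rho> (switch_group \<Gamma> X0)"
  have H_closed: "closed_subgroup \<Gamma> ?H"
    unfolding star_def using S_C assms(2) by (intro closed_subgroup_closed_generated) auto
  interpret H: closed_group "Rl \<Gamma>" "Rr \<Gamma>" "adjacent \<Gamma>" ?H
    using closed_group_adjacent[OF assms(1) H_closed] S_gen[of X0] star_gen[of X0] by blast

  have "G \<subseteq> ?H"
  proof
    fix \<sigma> assume \<sigma>: "\<sigma> \<in> G"
    then have perm: "\<sigma> \<in> side_perms (Rl \<Gamma>) (Rr \<Gamma>)" and rect: "rectangular \<sigma>"
      using assms(6) switch_group_subset_rectangular[OF assms(1)] carrier_Sym_lr by blast+
    \<comment> \<open>The vertices at which every switch is available in \<open>?H\<close>.\<close>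
    define Z where "Z = (\<Union>i\<in>X0. part \<Gamma> i)"
    show "\<sigma> \<in> ?H"
    proof (rule H.rectangular_mem[where Z = Z and \<rho> = \<rho>])
      fix \<tau> v
      assume \<tau>: "\<tau> \<in> side_perms (Rl \<Gamma>) (Rr \<Gamma>)" and v: "v \<in> Z"
        and fl: "\<forall>a\<in>Rl \<Gamma>. \<forall>b\<in>Rr \<Gamma>. flips \<tau> a b \<longleftrightarrow> a = v \<or> b = v"
      have \<tau>C: "\<tau> \<in> ?C" using \<tau> by (simp add: carrier_Sym_lr)
      then have "\<tau> \<in> sw X0"
        using v fl is_switch_vertex_iff_flips[OF assms(1) \<tau>C] by (auto simp: sw_def Z_def)
      then show "\<tau> \<in> ?H" using S_gen[of X0] star_gen[of X0] by blast
    next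
      fix \<eta> v assume \<eta>: "\<eta> \<in> side_perms (Rl \<Gamma>) (Rr \<Gamma>)" and "v \<in> Z"
      then obtain i where i: "i \<in> X0" "v \<in> part \<Gamma> i" by (auto simp: Z_def)
      then have "\<eta> v \<in> part \<Gamma> i" using side_permsD(1,2)[OF \<eta>, of v] by (cases i) auto
      then show "\<eta> v \<in> Z" using i(1) by (auto simp: Z_def)
    next
      show "Z \<subseteq> Rl \<Gamma> \<union> Rr \<Gamma>"
      proof
        fix v assume "v \<in> Z"
        then obtain i where "v \<in> part \<Gamma> i" by (auto simp: Z_def)
        then show "v \<in> Rl \<Gamma> \<union> Rr \<Gamma>" by (cases i) auto
      qed
    next
      show "\<rho> \<in> ?H" using star_gen[of X0] by blast
      have "card ({a, b} \<inter> Rl \<Gamma>) = 1" if "a \<in> Rl \<Gamma>" "b \<in> Rr \<Gamma>" for a b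
      proof -
        have "{a, b} \<inter> Rl \<Gamma> = {a}" using that disjoint by auto
        then show ?thesis by simp
      qed
      then show "\<forall>a\<in>Rl \<Gamma>. \<forall>b\<in>Rr \<Gamma>. flips \<rho> a b"
        using assms(3) unfolding is_switch_iff_flips[OF assms(1,2)] by blast
    next
      show "Rl \<Gamma> \<subseteq> Z \<or> (\<forall>a\<in>Rl \<Gamma>. \<forall>a'\<in>Rl \<Gamma>. \<forall>b\<in>Rr \<Gamma>. flips \<sigma> a b = flips \<sigma> a' b)"
      proof (rule disjCI)
        assume "\<not> (\<forall>a\<in>Rl \<Gamma>. \<forall>a'\<in>Rl \<Gamma>. \<forall>b\<in>Rr \<Gamma>. flips \<sigma> a b = flips \<sigma> a' b)"
        then obtain a a' b where ab: "a \<in> Rl \<Gamma>" "a' \<in> Rl \<Gamma>" "b \<in> Rr \<Gamma>" "flips \<sigma> a b \<noteq> flips \<sigma> a' b"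
          by blast
        \<comment> \<open>Two rows of the matrix of \<open>\<sigma>\<close> differ, so
          \<open>G\<close> contains all switches at left vertices, and \<open>Lft\<close> belongs to
          \<open>X0\<close>.\<close>
        have "sw {Lft} \<subseteq> G"
        proof
          fix s assume "s \<in> sw {Lft}"
          then obtain u where s: "s \<in> ?C" "u \<in> Rl \<Gamma>" "is_switch \<Gamma> {u} s" by (auto simp: sw_def)
          have "b \<noteq> u" if "b \<in> Rr \<Gamma>" for b using that s(2) disjoint by blast
          then have "\<forall>a\<in>Rl \<Gamma>. \<forall>b\<in>Rr \<Gamma>. flips s a b \<longleftrightarrow> a = u"
            using iffD1[OF is_switch_vertex_iff_flips[OF assms(1) s(1)] s(3)] by simp
          with s show "s \<in> G"
            using G.switch_mem_if_nonconstant[OF \<sigma> rect ab] by (simp add: carrier_Sym_lr)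
        qed
        then show "Rl \<Gamma> \<subseteq> Z" by (auto simp: X0_def Z_def)
      qed
    next
      show "Rr \<Gamma> \<subseteq> Z \<or> (\<forall>a\<in>Rl \<Gamma>. \<forall>b\<in>Rr \<Gamma>. \<forall>b'\<in>Rr \<Gamma>. flips \<sigma> a b = flips \<sigma> a b')"
      proof (rule disjCI)
        assume "\<not> (\<forall>a\<in>Rl \<Gamma>. \<forall>b\<in>Rr \<Gamma>. \<forall>b'\<in>Rr \<Gamma>. flips \<sigma> a b = flips \<sigma> a b')"
        then obtain a b b' where ab: "a \<in> Rl \<Gamma>" "b \<in> Rr \<Gamma>" "b' \<in> Rr \<Gamma>" "flips \<sigma> b a \<noteq> flips \<sigma> b' a"
          using flips_commute[of \<sigma>] by metis
        \<comment> \<open>Columns are treated as rows of the transposed matrix, through the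
          interpretation with exchanged sides.\<close>
        have rect': "G'.rectangular \<sigma>" using rect by (simp add: rectangular_dual)
        have "sw {Rgt} \<subseteq> G"
        proof
          fix s assume "s \<in> sw {Rgt}"
          then obtain u where s: "s \<in> ?C" "u \<in> Rr \<Gamma>" "is_switch \<Gamma> {u} s" by (auto simp: sw_def)
          have "a \<noteq> u" if "a \<in> Rl \<Gamma>" for a using that s(2) disjoint by blast
          then have "\<forall>a\<in>Rl \<Gamma>. \<forall>b\<in>Rr \<Gamma>. flips s a b \<longleftrightarrow> b = u"
            using iffD1[OF is_switch_vertex_iff_flips[OF assms(1) s(1)] s(3)] by simp
          then have "\<forall>b\<in>Rr \<Gamma>. \<forall>a\<in>Rl \<Gamma>. flips s b a \<longleftrightarrow> b = u"
            using flips_commute[of s] by metis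
          with s show "s \<in> G"
            using G'.switch_mem_if_nonconstant[OF \<sigma> rect' ab(2,3,1,4)]
            by (simp add: carrier_Sym_lr side_perms_commute[of "Rl \<Gamma>" "Rr \<Gamma>"])
        qed
        then show "Rr \<Gamma> \<subseteq> Z" by (auto simp: X0_def Z_def)
      qed
    qed (fact perm rect)+
  qed
  moreover have "?H \<subseteq> G" using star_iff by blast
  ultimately show ?thesis unfolding largest by blast
qed

end
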